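(* Let $R$ be a Noetherian complete local ring. Let $\mathrm{i}$ be a relative interior operation on pairs $A\subseteq B$ of $R$-modules that are both Noetherian or both Artinian, and let $\mathrm{cl}:=\mathrm{i}^{\smile}$ be its dual closure operation. Then there exists an order-reversing one-to-one correspondence between the poset of $\mathrm{i}$-expansions of $A$ in $B$ and the poset of $\mathrm{cl}$-reductions of $(B/A)^\vee$ in $B^\vee$. Under this correspondence, an $\mathrm{i}$-expansion $C$ of $A$ in $B$ maps to $(B/C)^\vee$, a $\mathrm{cl}$-reduction of $(B/A)^\vee$ in $B^\vee$.
   Context: Let $(R,\mathfrak{m},k)$ be a complete Noetherian local ring, $E=E_R(k)$, $(-)^\vee=\mathrm{Hom}_R(-,E)$. For $A\subseteq B$, $(B/A)^\vee$ is regarded as a submodule of $B^\vee$, and for $B$ Noetherian or Artinian, $B^{\vee\vee}$ is identified with $B$. A relative interior operation $\mathrm{i}$ assigns to each pair $A\subseteq B$ in the class a submodule $A^B_{\mathrm{i}}$ of $B$, compatibly with isomorphisms of $B$, such that $A^B_{\mathrm{i}}\subseteq A$; $A\subseteq C\subseteq B$ implies $A^B_{\mathrm{i}}\subseteq C^B_{\mathrm{i}}$; and $(A^B_{\mathrm{i}})^B_{\mathrm{i}}=A^B_{\mathrm{i}}$. Its dual is the closure operation (extensive, order-preserving on submodules, idempotent) given by $$N^{\mathrm{cl}}_M=\left(\frac{M^\vee}{\left((M/N)^\vee\right)^{M^\vee}_{\mathrm{i}}}\right)^\vee\subseteq M\qquad (N\subseteq M).$$ An $\mathrm{i}$-expansion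 of $A$ in $B$ is a submodule $C$ with $A\subseteq C\subseteq B$ and $A^B_{\mathrm{i}}=C^B_{\mathrm{i}}$. A $\mathrm{cl}$-reduction of $N$ in $M$ is a submodule $L\subseteq N$ with $L^{\mathrm{cl}}_M=N^{\mathrm{cl}}_M$. Both posets are ordered by inclusion. *)

theory Defs
  imports "HOL-Algebra.Algebra" "HOL-Library.Equipollence"
begin

section \<open>Complete local rings\<close>

definition local_cring :: "('r, 'x) ring_scheme \<Rightarrow> 'r set \<Rightarrow> bool" where
  "local_cring R \<mm> \<longleftrightarrow> cring R \<and> maximalideal \<mm> R \<and> (\<forall>J. maximalideal J R \<longrightarrow> J = \<mm>)"

text \<open>
  The canonical map from \<open>R\<close> to the inverse limit of the rings \<open>R/I\<^sup>n\<close> is bijective. An element of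
  the limit is given by representatives \<open>x n\<close> of compatible classes in \<open>R/I\<^sup>n\<close>.
\<close>

definition adically_complete :: "('r, 'x) ring_scheme \<Rightarrow> 'r set \<Rightarrow> bool" where
  "adically_complete R I \<longleftrightarrow>
     (\<forall>x :: nat \<Rightarrow> 'r.
        (\<forall>n. x n \<in> carrier R \<and> x (Suc n) \<ominus>\<^bsub>R\<^esub> x n \<in> I [^]\<^bsub>ideals_set R\<^esub> n) \<longrightarrow>
        (\<exists>!y. y \<in> carrier R \<and> (\<forall>n. y \<ominus>\<^bsub>R\<^esub> x n \<in> I [^]\<^bsub>ideals_set R\<^esub> n)))"


section \<open>Modules\<close>

text \<open>
  The record type of modules extends that of rings, so it has fields for a product and a unit,
  which play no role for modules; they are left \<^const>\<open>undefined\<close> below where nothing natural is available.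
\<close>

definition ring_as_module :: "('r, 'x) ring_scheme \<Rightarrow> ('r, 'r) module" where
  "ring_as_module R = \<lparr>carrier = carrier R, monoid.mult = (\<otimes>\<^bsub>R\<^esub>), one = \<one>\<^bsub>R\<^esub>,
     ring.zero = \<zero>\<^bsub>R\<^esub>, ring.add = (\<oplus>\<^bsub>R\<^esub>), smult = (\<otimes>\<^bsub>R\<^esub>)\<rparr>"

definition quot_module :: "('r, 'm) module \<Rightarrow> 'm set \<Rightarrow> ('r, 'm set) module" where
  "quot_module M N = \<lparr>carrier = a_rcosets\<^bsub>M\<^esub> N, monoid.mult = undefined, one = undefined,
     ring.zero = N, ring.add = set_add M, smult = (\<lambda>r S. \<Union>x\<in>S. N +>\<^bsub>M\<^esub> (r \<odot>\<^bsub>M\<^esub> x))\<rparr>"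

definition mod_homs ::
  "('r, 'x) ring_scheme \<Rightarrow> ('r, 'm) module \<Rightarrow> ('r, 'n) module \<Rightarrow> ('m \<Rightarrow> 'n) set" where
  "mod_homs R M N = {f \<in> carrier M \<rightarrow> carrier N.
     (\<forall>x\<in>carrier M. \<forall>y\<in>carrier M. f (x \<oplus>\<^bsub>M\<^esub> y) = f x \<oplus>\<^bsub>N\<^esub> f y) \<and>
     (\<forall>r\<in>carrier R. \<forall>x\<in>carrier M. f (r \<odot>\<^bsub>M\<^esub> x) = r \<odot>\<^bsub>N\<^esub> f x)}"

definition mod_isos ::
  "('r, 'x) ring_scheme \<Rightarrow> ('r, 'm) module \<Rightarrow> ('r, 'n) module \<Rightarrow> ('m \<Rightarrow> 'n) set" where
  "mod_isos R M N = {f \<in> mod_homs R M N. bij_betw f (carrier M) (carrier N)}"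

definition noetherian_module :: "('r, 'x) ring_scheme \<Rightarrow> ('r, 'm) module \<Rightarrow> bool" where
  "noetherian_module R M \<longleftrightarrow> module R M \<and>
     (\<forall>C :: nat \<Rightarrow> 'm set. (\<forall>n. submodule (C n) R M \<and> C n \<subseteq> C (Suc n)) \<longrightarrow>
        (\<exists>n. \<forall>k\<ge>n. C k = C n))"

definition artinian_module :: "('r, 'x) ring_scheme \<Rightarrow> ('r, 'm) module \<Rightarrow> bool" where
  "artinian_module R M \<longleftrightarrow> module R M \<and>
     (\<forall>C :: nat \<Rightarrow> 'm set. (\<forall>n. submodule (C n) R M \<and> C (Suc n) \<subseteq> C n) \<longrightarrow>
        (\<exists>n. \<forall>k\<ge>n. C k = C n))"


section \<open>Injective hulls\<close>

text \<open>
  HOL cannot quantify over modules with carriers in all types, so ``all modules'' means all modules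
  whose elements lie in a type \<open>'u\<close>, a universe. Every Noetherian or Artinian module over a
  Noetherian ring \<open>R\<close> has at most \<open>max(|R|, \<aleph>\<^sub>0)\<close> elements, hence under the following condition an
  isomorphic copy in the universe. The copies of \<open>R\<close> and of its ideals lie there as well, so that
  (by Baer's criterion) injectivity tested in the universe is injectivity.
\<close>

definition large_universe :: "('r, 'x) ring_scheme \<Rightarrow> 'u itself \<Rightarrow> bool" where
  "large_universe R U \<longleftrightarrow> infinite (UNIV :: 'u set) \<and> carrier R \<lesssim> (UNIV :: 'u set)"

definition injective_module ::
  "('r, 'x) ring_scheme \<Rightarrow> 'u itself \<Rightarrow> ('r, 'e) module \<Rightarrow> bool" where
  "injective_module R U E \<longleftrightarrow> module R E \<and>
     (\<forall>(N :: ('r, 'u) module) A f.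
        module R N \<longrightarrow> submodule A R N \<longrightarrow> f \<in> mod_homs R (N\<lparr>carrier := A\<rparr>) E \<longrightarrow>
        (\<exists>g \<in> mod_homs R N E. \<forall>a\<in>A. g a = f a))"

definition essential_submodule ::
  "('r, 'x) ring_scheme \<Rightarrow> 'm set \<Rightarrow> ('r, 'm) module \<Rightarrow> bool" where
  "essential_submodule R K M \<longleftrightarrow> submodule K R M \<and>
     (\<forall>N. submodule N R M \<longrightarrow> N \<noteq> {\<zero>\<^bsub>M\<^esub>} \<longrightarrow> N \<inter> K \<noteq> {\<zero>\<^bsub>M\<^esub>})"

definition injective_hull ::
  "('r, 'x) ring_scheme \<Rightarrow> 'u itself \<Rightarrow> ('r, 'k) module \<Rightarrow> ('r, 'e) module \<Rightarrow> bool" where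
  "injective_hull R U K E \<longleftrightarrow> injective_module R U E \<and>
     (\<exists>j \<in> mod_homs R K E. inj_on j (carrier K) \<and> essential_submodule R (j ` carrier K) E)"


section \<open>Matlis duality\<close>

text \<open>Homomorphisms are represented by functions that are \<^const>\<open>undefined\<close> off the carrier.\<close>

definition dual ::
  "('r, 'x) ring_scheme \<Rightarrow> ('r, 'e) module \<Rightarrow> ('r, 'm) module \<Rightarrow> ('r, 'm \<Rightarrow> 'e) module" where
  "dual R E M = \<lparr>carrier = mod_homs R M E \<inter> extensional (carrier M),
     monoid.mult = undefined, one = undefined,
     ring.zero = (\<lambda>x\<in>carrier M. \<zero>\<^bsub>E\<^esub>),
     ring.add = (\<lambda>f g. \<lambda>x\<in>carrier M. f x \<oplus>\<^bsub>E\<^esub> g x),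
     smult = (\<lambda>r f. \<lambda>x\<in>carrier M. r \<odot>\<^bsub>E\<^esub> f x)\<rparr>"

text \<open>The dual of \<open>M/N\<close> as a submodule of the dual of \<open>M\<close>, by composition with \<open>M \<rightarrow> M/N\<close>.\<close>

definition dual_quot ::
  "('r, 'x) ring_scheme \<Rightarrow> ('r, 'e) module \<Rightarrow> ('r, 'm) module \<Rightarrow> 'm set \<Rightarrow> ('m \<Rightarrow> 'e) set" where
  "dual_quot R E M N =
     (\<lambda>g. \<lambda>x\<in>carrier M. g (N +>\<^bsub>M\<^esub> x)) ` carrier (dual R E (quot_module M N))"

definition eval_map ::
  "('r, 'x) ring_scheme \<Rightarrow> ('r, 'e) module \<Rightarrow> ('r, 'm) module \<Rightarrow> 'm \<Rightarrow> ('m \<Rightarrow> 'e) \<Rightarrow> 'e" where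
  "eval_map R E M x = (\<lambda>f\<in>carrier (dual R E M). f x)"


section \<open>Relative interior operations\<close>

definition admissible_pair ::
  "('r, 'x) ring_scheme \<Rightarrow> 'm set \<Rightarrow> ('r, 'm) module \<Rightarrow> bool" where
  "admissible_pair R A B \<longleftrightarrow> module R B \<and> submodule A R B \<and>
     (noetherian_module R (B\<lparr>carrier := A\<rparr>) \<and> noetherian_module R B \<or>
      artinian_module R (B\<lparr>carrier := A\<rparr>) \<and> artinian_module R B)"

definition relative_interior ::
  "('r, 'x) ring_scheme \<Rightarrow> (('r, 'u) module \<Rightarrow> 'u set \<Rightarrow> 'u set) \<Rightarrow> bool" where
  "relative_interior R i \<longleftrightarrow>
     (\<forall>A B. admissible_pair R A B \<longrightarrow>
        submodule (i B A) R B \<and> i B A \<subseteq> A \<and> i B (i B A) = i B A) \<and>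
     (\<forall>A C B. admissible_pair R A B \<longrightarrow> admissible_pair R C B \<longrightarrow> A \<subseteq> C \<longrightarrow>
        i B A \<subseteq> i B C) \<and>
     (\<forall>A B B' \<phi>. admissible_pair R A B \<longrightarrow> module R B' \<longrightarrow> \<phi> \<in> mod_isos R B B' \<longrightarrow>
        i B' (\<phi> ` A) = \<phi> ` (i B A))"

text \<open>
  A relative interior operation is given on modules in the universe \<open>'u\<close>. On a module \<open>M\<close> with
  elements in another type, such as a dual, it is computed in an isomorphic copy \<open>U\<close> of \<open>M\<close> in the
  universe; by compatibility with isomorphisms the choice of the copy does not matter.
\<close>

definition interior_on ::
  "('r, 'x) ring_scheme \<Rightarrow> (('r, 'u) module \<Rightarrow> 'u set \<Rightarrow> 'u set) \<Rightarrow>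
   ('r, 'm) module \<Rightarrow> 'm set \<Rightarrow> 'm set" where
  "interior_on R i M A =
     {x \<in> carrier M. \<exists>(U :: ('r, 'u) module) \<phi>.
        module R U \<and> \<phi> \<in> mod_isos R M U \<and> \<phi> x \<in> i U (\<phi> ` A)}"

lemma interior_on_universe:
  fixes R :: "('r, 'x) ring_scheme" and B :: "('r, 'u) module"
  assumes "relative_interior R i" and "admissible_pair R A B"
  shows "interior_on R i B A = i B A"
proof -
  have mod: "module R B" and "submodule A R B"
    using assms(2) unfolding admissible_pair_def by blast+
  hence "A \<subseteq> carrier B" by (rule module.submoduleE(1))
  moreover have "i B A \<subseteq> A"
    using assms(1)[unfolded relative_interior_def, THEN conjunct1] assms(2) by blast
  ultimately have sub: "i B A \<subseteq> carrier B" by blast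
  have iso: "i U (\<phi> ` A) = \<phi> ` (i B A)" if "module R U" "\<phi> \<in> mod_isos R B U" for U \<phi>
    using assms(1)[unfolded relative_interior_def, THEN conjunct2, THEN conjunct2, rule_format]
      assms(2) that by blast
  have id: "id \<in> mod_isos R B B"
    unfolding mod_isos_def mod_homs_def by (simp add: bij_betw_id)
  show ?thesis
  proof (intro equalityI subsetI)
    fix x assume "x \<in> i B A"
    hence "x \<in> carrier B" "id x \<in> i B (id ` A)" using sub by auto
    thus "x \<in> interior_on R i B A" unfolding interior_on_def using mod id by blast
  next
    fix x assume "x \<in> interior_on R i B A"
    then obtain U :: "('r, 'u) module" and \<phi> where x: "x \<in> carrier B"
      and U: "module R U" "\<phi> \<in> mod_isos R B U" and "\<phi> x \<in> i U (\<phi> ` A)"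
      unfolding interior_on_def by blast
    hence "\<phi> x \<in> \<phi> ` (i B A)" using iso[OF U] by blast
    moreover have "inj_on \<phi> (carrier B)" using U(2) by (simp add: mod_isos_def bij_betw_def)
    ultimately show "x \<in> i B A" using x sub by (meson inj_on_image_mem_iff)
  qed
qed

text \<open>
  The submodule of \<open>M\<close> corresponding, under the evaluation map from \<open>M\<close> to its double dual, to the
  dual of the quotient of the dual of \<open>M\<close> by the interior of the dual of \<open>M/N\<close>.
\<close>

definition dual_closure ::
  "('r, 'x) ring_scheme \<Rightarrow> ('r, 'e) module \<Rightarrow> (('r, 'u) module \<Rightarrow> 'u set \<Rightarrow> 'u set) \<Rightarrow>
   ('r, 'm) module \<Rightarrow> 'm set \<Rightarrow> 'm set" where
  "dual_closure R E i M N =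
     {x \<in> carrier M. eval_map R E M x \<in>
        dual_quot R E (dual R E M) (interior_on R i (dual R E M) (dual_quot R E M N))}"

definition expansions ::
  "('r, 'x) ring_scheme \<Rightarrow> (('r, 'm) module \<Rightarrow> 'm set \<Rightarrow> 'm set) \<Rightarrow>
   ('r, 'm) module \<Rightarrow> 'm set \<Rightarrow> 'm set set" where
  "expansions R i B A = {C. submodule C R B \<and> A \<subseteq> C \<and> i B A = i B C}"

definition reductions ::
  "('r, 'x) ring_scheme \<Rightarrow> (('r, 'm) module \<Rightarrow> 'm set \<Rightarrow> 'm set) \<Rightarrow>
   ('r, 'm) module \<Rightarrow> 'm set \<Rightarrow> 'm set set" where
  "reductions R cl M N = {L. submodule L R M \<and> L \<subseteq> N \<and> cl M L = cl M N}"

end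

theory Submission
  imports Defs
begin

text \<open>
  Write \<open>B\<^sup>\<or> = Hom(B, E)\<close>. The submodule \<open>(B/C)\<^sup>\<or>\<close> of \<open>B\<^sup>\<or>\<close> is the annihilator of \<open>C\<close>, and the theorem
  is a formal consequence of Matlis duality in the following form: for \<open>B\<close> Noetherian or Artinian,
  taking annihilators is an inclusion-reversing bijection from the submodules of \<open>B\<close> onto those of
  \<open>B\<^sup>\<or>\<close>, and the evaluation map \<open>B \<rightarrow> B\<^sup>\<or>\<^sup>\<or>\<close> is an isomorphism. Granting this, transport along evaluation
  shows that the dual closure of the annihilator of \<open>C\<close> is the annihilator of the interior of \<open>C\<close>
  (\<open>dual_closure_eq\<close>). As annihilators determine submodules, \<open>C\<close> and \<open>A\<close> have equal interiors if and
  only if their annihilators have equal closures.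

  Annihilators separate the submodules of \<open>B\<close> because \<open>E\<close> is an injective cogenerator. The other
  parts of the duality rest on one statement about \<open>E\<close>, \<open>factor_through\<close>: if \<open>f\<close> and \<open>g\<close> are homomorphisms
  from any module to \<open>E\<close> and \<open>ker g \<subseteq> ker f\<close>, then \<open>f = r g\<close> for some \<open>r \<in> R\<close>. It extends to finitely many
  maps (\<open>in_span_if_kernels\<close>): if the common kernel of \<open>g\<^sub>1, \<dots>, g\<^sub>n\<close> lies in \<open>ker f\<close>, then \<open>f\<close> is a
  linear combination of the \<open>g\<^sub>i\<close>. When \<open>f\<close> is defined on all of \<open>E\<close> and \<open>g\<close> is the identity, the
  statement for one map says that every endomorphism of \<open>E\<close> is multiplication by an element of \<open>R\<close>. Since
  partially defined maps are admitted, no functional has to be extended on the way: the argument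
  treats \<open>E\<close> as an essential extension of \<open>k\<close> over a complete ring.

  The proof of \<open>factor_through\<close> has two steps. If a power of \<open>\<mm>\<close> kills \<open>g\<close>, then \<open>r\<close> is found by
  induction on the exponent, the essential point being that the socle of \<open>E\<close> is one-dimensional over \<open>k\<close>
  (\<open>factor_torsion\<close>). In general the domain is the increasing union of the submodules on which \<open>g\<close> is
  killed by \<open>\<mm>\<^sup>n\<close>, each of which yields a scalar. Since descending chains of ideals stabilise modulo every
  power of \<open>\<mm>\<close> (\<open>stabilising_pow_m\<close>), these scalars can be chosen to form a Cauchy sequence, and
  completeness of \<open>R\<close> supplies its limit.

  If \<open>M\<close> is generated by \<open>b\<^sub>1, \<dots>, b\<^sub>n\<close>, the evaluations at the \<open>b\<^sub>i\<close> have common kernel \<open>0\<close> on \<open>M\<^sup>\<or>\<close>, so every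
  functional on a submodule of \<open>M\<^sup>\<or>\<close> is evaluation at an element of \<open>M\<close> (\<open>functional_is_evaluation\<close>). This
  gives both parts of the duality for Noetherian \<open>M\<close>. For Artinian \<open>M\<close>, the common kernel of a set of
  functionals is already that of a finite subset, so \<open>M\<^sup>\<or>\<close> is finitely generated and its submodules
  are annihilators (\<open>artinian_dual_span\<close>); reflexivity follows by applying the finitely generated case
  to \<open>M\<^sup>\<or>\<close> and the image of \<open>M\<close> in \<open>M\<^sup>\<or>\<^sup>\<or>\<close>.
\<close>

section \<open>Noetherian local rings\<close>

lemma (in noetherian_ring) ideals_have_maximal:
  assumes "\<A> \<noteq> {}" and "\<And>I. I \<in> \<A> \<Longrightarrow> ideal I R"
  shows "\<exists>M\<in>\<A>. \<forall>I\<in>\<A>. M \<subseteq> I \<longrightarrow> I = M"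
proof (rule subset_Zorn_nonempty[OF assms(1)])
  fix \<C> assume "\<C> \<noteq> {}" and c: "subset.chain \<A> \<C>"
  have "subset.chain {I. ideal I R} \<C>"
    using c assms(2) unfolding pred_on.chain_def by blast
  then have "\<Union>\<C> \<in> \<C>" by (rule ideal_chain_is_trivial[OF \<open>\<C> \<noteq> {}\<close>])
  then show "\<Union>\<C> \<in> \<A>" using c unfolding pred_on.chain_def by blast
qed

context ring
begin

lemma in_set_add: "z \<in> I <+>\<^bsub>R\<^esub> J \<longleftrightarrow> (\<exists>x\<in>I. \<exists>y\<in>J. z = x \<oplus> y)"
  unfolding set_add_def' by blast

lemma set_add_mono_left: "I \<subseteq> I' \<Longrightarrow> I <+>\<^bsub>R\<^esub> J \<subseteq> I' <+>\<^bsub>R\<^esub> J"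
  unfolding in_set_add subset_iff by blast

lemma ideal_plus: "\<lbrakk>ideal I R; x \<in> I; y \<in> I\<rbrakk> \<Longrightarrow> x \<oplus> y \<in> I"
  by (simp add: additive_subgroup.a_closed ideal.axioms(1))

lemma ideal_diff: "\<lbrakk>ideal I R; x \<in> I; y \<in> I\<rbrakk> \<Longrightarrow> x \<ominus> y \<in> I"
  by (simp add: a_minus_def additive_subgroup.a_closed additive_subgroup.a_inv_closed ideal.axioms(1))

lemma set_add_subset_left: "\<lbrakk>ideal I R; ideal J R\<rbrakk> \<Longrightarrow> I \<subseteq> I <+>\<^bsub>R\<^esub> J"
proof
  fix x assume a: "ideal I R" "ideal J R" "x \<in> I"
  have "\<zero> \<in> J" using a(2) additive_subgroup.zero_closed ideal.axioms(1) by blast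
  then show "x \<in> I <+>\<^bsub>R\<^esub> J" using a ideal.Icarr[OF a(1,3)] r_zero[of x] unfolding in_set_add by metis
qed

lemma set_add_subset_right: "\<lbrakk>ideal I R; ideal J R\<rbrakk> \<Longrightarrow> J \<subseteq> I <+>\<^bsub>R\<^esub> J"
proof
  fix x assume a: "ideal I R" "ideal J R" "x \<in> J"
  have "\<zero> \<in> I" using a(1) additive_subgroup.zero_closed ideal.axioms(1) by blast
  then show "x \<in> I <+>\<^bsub>R\<^esub> J" using a ideal.Icarr[OF a(2,3)] l_zero[of x] unfolding in_set_add by metis
qed

end

locale noetherian_local = cring R for R (structure) +
  fixes \<mm>
  assumes noetherian: "noetherian_ring R"
    and ideal_m: "ideal \<mm> R"
    and unit: "\<lbrakk>a \<in> carrier R; a \<notin> \<mm>\<rbrakk> \<Longrightarrow> a \<in> Units R"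
begin

abbreviation pow_m :: "nat \<Rightarrow> 'a set" where
  "pow_m n \<equiv> \<mm> [^]\<^bsub>ideals_set R\<^esub> n"

lemma m_carrier: "a \<in> \<mm> \<Longrightarrow> a \<in> carrier R"
  using ideal.Icarr[OF ideal_m] .

lemma pow_m_0: "pow_m 0 = carrier R"
  by (simp add: nat_pow_def ideals_set_def)

lemma pow_m_Suc: "pow_m (Suc n) = ideal_prod R (pow_m n) \<mm>"
  by (simp add: nat_pow_def ideals_set_def)

lemma ideal_pow_m: "ideal (pow_m n) R"
  by (induction n) (simp_all only: pow_m_0 oneideal pow_m_Suc ideal_prod_is_ideal[OF _ ideal_m])

lemma pow_m_carrier: "a \<in> pow_m n \<Longrightarrow> a \<in> carrier R"
  using ideal.Icarr[OF ideal_pow_m] .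

lemma pow_m_mult: "\<lbrakk>a \<in> pow_m n; b \<in> \<mm>\<rbrakk> \<Longrightarrow> a \<otimes> b \<in> pow_m (Suc n)"
  unfolding pow_m_Suc by (rule ideal_prod.prod)

lemma pow_m_antimono: "n \<le> k \<Longrightarrow> pow_m k \<subseteq> pow_m n"
proof (induction k rule: dec_induct)
  case (step k)
  then show ?case using ideal_prod_inter[OF ideal_pow_m ideal_m] unfolding pow_m_Suc by blast
qed simp

text \<open>
  The descending chain condition for the ring \<open>R/J\<close>, expressed with ideals of \<open>R\<close>.
\<close>

definition stabilising :: "'a set \<Rightarrow> bool" where
  "stabilising J \<longleftrightarrow> (\<forall>C :: nat \<Rightarrow> 'a set.
     (\<forall>n. ideal (C n) R \<and> J \<subseteq> C n \<and> C (Suc n) \<subseteq> C n) \<longrightarrow> (\<exists>n. \<forall>k\<ge>n. C k = C n))"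

lemma stabilising_carrier: "stabilising (carrier R)"
  unfolding stabilising_def
proof (intro allI impI)
  fix C :: "nat \<Rightarrow> 'a set"
  assume "\<forall>n. ideal (C n) R \<and> carrier R \<subseteq> C n \<and> C (Suc n) \<subseteq> C n"
  then have "ideal (C k) R" "carrier R \<subseteq> C k" for k by simp_all
  then have "C k = carrier R" for k
    using additive_subgroup.a_subset[OF ideal.axioms(1), of "C k" R] by (meson subset_antisym)
  then show "\<exists>n. \<forall>k\<ge>n. C k = C n" by simp
qed

text \<open>
  \<open>R/J\<close> is an extension of \<open>R/(J + Rx)\<close> by a module \<open>(J + Rx)/J\<close> without proper nonzero submodules, so a
  chain can shrink only once more after its image in \<open>R/(J + Rx)\<close> has become constant.
\<close>

lemma stabilising_step:
  assumes J: "ideal J R" and x: "x \<in> carrier R" and mx: "\<And>a. a \<in> \<mm> \<Longrightarrow> a \<otimes> x \<in> J"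
    and st: "stabilising (J <+>\<^bsub>R\<^esub> PIdl x)"
  shows "stabilising J"
  unfolding stabilising_def
proof (intro allI impI)
  fix C :: "nat \<Rightarrow> 'a set"
  assume C: "\<forall>n. ideal (C n) R \<and> J \<subseteq> C n \<and> C (Suc n) \<subseteq> C n"
  have idC: "ideal (C n) R" and JC: "J \<subseteq> C n" and dec: "C (Suc n) \<subseteq> C n" for n
    using C[rule_format, of n] by simp_all
  have anti: "n \<le> k \<Longrightarrow> C k \<subseteq> C n" for n k using lift_Suc_antimono_le[of C n k] dec by simp
  have Px: "ideal (PIdl x) R" using x by (rule cgenideal_ideal)
  show "\<exists>n. \<forall>k\<ge>n. C k = C n"
  proof (cases "\<forall>n. x \<in> C n")
    case True
    have "J <+>\<^bsub>R\<^esub> PIdl x \<subseteq> C n" for n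
    proof
      fix z assume "z \<in> J <+>\<^bsub>R\<^esub> PIdl x"
      then obtain u v where "u \<in> J" "v \<in> PIdl x" "z = u \<oplus> v" unfolding in_set_add by auto
      moreover have "PIdl x \<subseteq> C n" using cgenideal_minimal[OF idC] True by blast
      ultimately show "z \<in> C n" using JC[of n] ideal_plus[OF idC] by blast
    qed
    then show ?thesis using st[unfolded stabilising_def, rule_format, of C] idC dec by simp
  next
    case False
    then obtain n1 where n1: "x \<notin> C n1" by blast
    have "\<exists>n. \<forall>k\<ge>n. C k <+>\<^bsub>R\<^esub> PIdl x = C n <+>\<^bsub>R\<^esub> PIdl x"
      using st[unfolded stabilising_def, rule_format, of "\<lambda>n. C n <+>\<^bsub>R\<^esub> PIdl x"]
        add_ideals[OF idC Px] set_add_mono_left[OF JC] set_add_mono_left[OF dec] by simp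
    then obtain n0 where n0: "\<And>k. k \<ge> n0 \<Longrightarrow> C k <+>\<^bsub>R\<^esub> PIdl x = C n0 <+>\<^bsub>R\<^esub> PIdl x"
      by blast
    \<comment> \<open>From \<open>n1\<close> on, no unit multiple of \<open>x\<close> lies in the chain, so only \<open>\<mm>x \<subseteq> J\<close> can contribute.\<close>
    define N where "N = max n0 n1"
    have "C N \<subseteq> C k" if "k \<ge> N" for k
    proof
      fix c assume c: "c \<in> C N"
      note idN = idC[of N] and idk = idC[of k]
      have "c \<in> C k <+>\<^bsub>R\<^esub> PIdl x"
        using c set_add_subset_left[OF idN Px] n0[of N] n0[of k] that N_def by auto
      then obtain c' r where c': "c' \<in> C k" and r: "r \<in> carrier R" and eq: "c = c' \<oplus> r \<otimes> x"
        unfolding in_set_add cgenideal_def by blast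
      have cN: "c' \<in> C N" using c' anti[OF that] by blast
      have car: "c' \<in> carrier R" "c \<in> carrier R" using cN c ideal.Icarr[OF idN] by blast+
      have "r \<otimes> x = c \<ominus> c'" using car r x unfolding eq by algebra
      then have rx: "r \<otimes> x \<in> C N" using ideal_diff[OF idN c cN] by simp
      have "r \<in> \<mm>"
      proof (rule ccontr)
        assume "r \<notin> \<mm>"
        then have u: "r \<in> Units R" using unit r by blast
        have "inv r \<otimes> (r \<otimes> x) \<in> C N" using ideal.I_l_closed[OF idN rx] u by blast
        then have "x \<in> C N" using u x r by (simp add: m_assoc[symmetric])
        then show False using n1 anti[of n1 N] N_def by auto
      qed
      then have "r \<otimes> x \<in> C k" using mx JC by blast
      then show "c \<in> C k" unfolding eq using ideal_plus[OF idk c'] by blast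
    qed
    then have "\<forall>k\<ge>N. C k = C N" using anti[of N] by (simp add: set_eq_subset)
    then show ?thesis by (rule exI)
  qed
qed

text \<open>
  \<open>R/\<mm>\<^sup>k\<close> is Artinian. If not, choose \<open>J \<supseteq> \<mm>\<^sup>k\<close> maximal among the ideals where the chain condition fails. The
  last power of \<open>\<mm>\<close> not contained in \<open>J\<close> provides some \<open>x \<notin> J\<close> with \<open>\<mm>x \<subseteq> J\<close>, and the preceding lemma
  carries the condition from \<open>J + Rx\<close> down to \<open>J\<close>.
\<close>

lemma stabilising_pow_m: "stabilising (pow_m k)"
proof (rule ccontr)
  assume n: "\<not> stabilising (pow_m k)"
  define \<A> where "\<A> = {J. ideal J R \<and> pow_m k \<subseteq> J \<and> \<not> stabilising J}"
  have "pow_m k \<in> \<A>" using ideal_pow_m n by (simp add: \<A>_def)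
  then have "\<exists>M\<in>\<A>. \<forall>I\<in>\<A>. M \<subseteq> I \<longrightarrow> I = M"
    by (intro noetherian_ring.ideals_have_maximal[OF noetherian]) (auto simp: \<A>_def)
  then obtain J where "J \<in> \<A>" and max: "\<And>I. \<lbrakk>I \<in> \<A>; J \<subseteq> I\<rbrakk> \<Longrightarrow> I = J" by auto
  then have J: "ideal J R" "pow_m k \<subseteq> J" "\<not> stabilising J" by (simp_all add: \<A>_def)
  have "J \<noteq> carrier R" using J(3) stabilising_carrier by auto
  define j where "j = (LEAST j. pow_m j \<subseteq> J)"
  have j: "pow_m j \<subseteq> J" unfolding j_def by (rule LeastI[of _ k]) (rule J(2))
  have "j \<noteq> 0"
  proof
    assume "j = 0"
    then have "carrier R \<subseteq> J" using j pow_m_0 by simp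
    moreover have "J \<subseteq> carrier R" using ideal.Icarr[OF J(1)] by (rule subsetI)
    ultimately show False using \<open>J \<noteq> carrier R\<close> by simp
  qed
  then obtain i where i: "j = Suc i" using not0_implies_Suc by auto
  have "\<not> pow_m i \<subseteq> J" using not_less_Least[of i "\<lambda>j. pow_m j \<subseteq> J"] i unfolding j_def by auto
  then obtain x where x: "x \<in> pow_m i" "x \<notin> J" by auto
  have xc: "x \<in> carrier R" using x(1) by (rule pow_m_carrier)
  have Px: "ideal (PIdl x) R" using xc by (rule cgenideal_ideal)
  have mx: "a \<otimes> x \<in> J" if "a \<in> \<mm>" for a
    using pow_m_mult[OF x(1) that] j i m_comm[OF m_carrier[OF that] xc] by auto
  have sub: "J \<subseteq> J <+>\<^bsub>R\<^esub> PIdl x" and "x \<in> J <+>\<^bsub>R\<^esub> PIdl x"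
    using set_add_subset_left[OF J(1) Px] set_add_subset_right[OF J(1) Px] cgenideal_self[OF xc]
    by auto
  then have "J <+>\<^bsub>R\<^esub> PIdl x \<notin> \<A>" using max[OF _ sub] x(2) by metis
  then have "stabilising (J <+>\<^bsub>R\<^esub> PIdl x)"
    using add_ideals[OF J(1) Px] J(2) sub by (simp add: \<A>_def)
  then show False using stabilising_step[OF J(1) xc mx] J(3) by simp
qed

end

section \<open>Modules and homomorphisms\<close>

lemma mod_homs_iff:
  "f \<in> mod_homs R M N \<longleftrightarrow> (\<forall>x\<in>carrier M. f x \<in> carrier N) \<and>
     (\<forall>x\<in>carrier M. \<forall>y\<in>carrier M. f (x \<oplus>\<^bsub>M\<^esub> y) = f x \<oplus>\<^bsub>N\<^esub> f y) \<and>
     (\<forall>r\<in>carrier R. \<forall>x\<in>carrier M. f (r \<odot>\<^bsub>M\<^esub> x) = r \<odot>\<^bsub>N\<^esub> f x)"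
  unfolding mod_homs_def by (simp add: Pi_iff)

lemma mod_homs_closed: "\<lbrakk>f \<in> mod_homs R M N; x \<in> carrier M\<rbrakk> \<Longrightarrow> f x \<in> carrier N"
  and mod_homs_add: "\<lbrakk>f \<in> mod_homs R M N; x \<in> carrier M; y \<in> carrier M\<rbrakk>
    \<Longrightarrow> f (x \<oplus>\<^bsub>M\<^esub> y) = f x \<oplus>\<^bsub>N\<^esub> f y"
  and mod_homs_smult: "\<lbrakk>f \<in> mod_homs R M N; r \<in> carrier R; x \<in> carrier M\<rbrakk>
    \<Longrightarrow> f (r \<odot>\<^bsub>M\<^esub> x) = r \<odot>\<^bsub>N\<^esub> f x"
  by (simp_all add: mod_homs_iff)

lemma mod_homs_zero:
  assumes "module R M" "module R N" "f \<in> mod_homs R M N"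
  shows "f \<zero>\<^bsub>M\<^esub> = \<zero>\<^bsub>N\<^esub>"
proof -
  interpret M: module R M by fact
  interpret N: module R N by fact
  have "f (\<zero>\<^bsub>R\<^esub> \<odot>\<^bsub>M\<^esub> \<zero>\<^bsub>M\<^esub>) = \<zero>\<^bsub>R\<^esub> \<odot>\<^bsub>N\<^esub> f \<zero>\<^bsub>M\<^esub>"
    by (rule mod_homs_smult[OF assms(3)]) simp_all
  then show ?thesis using mod_homs_closed[OF assms(3), of "\<zero>\<^bsub>M\<^esub>"] by simp
qed

lemma mod_homs_restrict:
  "\<lbrakk>f \<in> mod_homs R (M\<lparr>carrier := Z\<rparr>) N; W \<subseteq> Z\<rbrakk> \<Longrightarrow> f \<in> mod_homs R (M\<lparr>carrier := W\<rparr>) N"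
  unfolding mod_homs_iff by (auto simp: subset_iff)

lemma (in module) submodule_iff:
  "submodule H R M \<longleftrightarrow> H \<subseteq> carrier M \<and> \<zero>\<^bsub>M\<^esub> \<in> H \<and> (\<forall>x\<in>H. \<forall>y\<in>H. x \<oplus>\<^bsub>M\<^esub> y \<in> H) \<and>
     (\<forall>a\<in>carrier R. \<forall>x\<in>H. a \<odot>\<^bsub>M\<^esub> x \<in> H)"
proof
  assume s: "submodule H R M"
  then obtain x where "x \<in> H" "x \<in> carrier M" using submoduleE(1,2)[OF s] by auto
  then have "\<zero>\<^bsub>M\<^esub> \<in> H" using submoduleE(4)[OF s, of "\<zero>\<^bsub>R\<^esub>" x] by simp
  then show "H \<subseteq> carrier M \<and> \<zero>\<^bsub>M\<^esub> \<in> H \<and> (\<forall>x\<in>H. \<forall>y\<in>H. x \<oplus>\<^bsub>M\<^esub> y \<in> H) \<and>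
     (\<forall>a\<in>carrier R. \<forall>x\<in>H. a \<odot>\<^bsub>M\<^esub> x \<in> H)"
    using submoduleE(1,4,5)[OF s] by simp
next
  assume H: "H \<subseteq> carrier M \<and> \<zero>\<^bsub>M\<^esub> \<in> H \<and> (\<forall>x\<in>H. \<forall>y\<in>H. x \<oplus>\<^bsub>M\<^esub> y \<in> H) \<and>
     (\<forall>a\<in>carrier R. \<forall>x\<in>H. a \<odot>\<^bsub>M\<^esub> x \<in> H)"
  show "submodule H R M"
  proof (rule submoduleI)
    fix x assume x: "x \<in> H"
    then have "x \<in> carrier M" using H by (simp add: subset_iff)
    then have "\<ominus>\<^bsub>M\<^esub> x = (\<ominus>\<^bsub>R\<^esub> \<one>\<^bsub>R\<^esub>) \<odot>\<^bsub>M\<^esub> x" using smult_l_minus[of "\<one>\<^bsub>R\<^esub>" x] by simp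
    then show "\<ominus>\<^bsub>M\<^esub> x \<in> H" using H x by simp
  qed (use H in simp_all)
qed

lemma (in module) colon_ideal:
  assumes W: "submodule W R M" and x: "x \<in> carrier M"
  shows "ideal {a \<in> carrier R. a \<odot>\<^bsub>M\<^esub> x \<in> W} R"
proof (rule idealI)
  note sub = W[unfolded submodule_iff]
  show "subgroup {a \<in> carrier R. a \<odot>\<^bsub>M\<^esub> x \<in> W} (add_monoid R)"
  proof (rule R.add.subgroupI)
    have "\<zero>\<^bsub>R\<^esub> \<in> {a \<in> carrier R. a \<odot>\<^bsub>M\<^esub> x \<in> W}" using x sub by simp
    then show "{a \<in> carrier R. a \<odot>\<^bsub>M\<^esub> x \<in> W} \<noteq> {}" by auto
  qed (use x sub submoduleE(3)[OF W] in \<open>auto simp: smult_l_distr smult_l_minus\<close>)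
  fix a b assume "a \<in> {a \<in> carrier R. a \<odot>\<^bsub>M\<^esub> x \<in> W}" "b \<in> carrier R"
  then show "b \<otimes>\<^bsub>R\<^esub> a \<in> {a \<in> carrier R. a \<odot>\<^bsub>M\<^esub> x \<in> W}"
    using x sub by (simp add: smult_assoc1)
  then show "a \<otimes>\<^bsub>R\<^esub> b \<in> {a \<in> carrier R. a \<odot>\<^bsub>M\<^esub> x \<in> W}"
    using \<open>a \<in> _\<close> \<open>b \<in> _\<close> by (simp add: R.m_comm)
qed (rule R.ring_axioms)

lemma (in module) eq_smult_if_diff_zero:
  assumes "x \<in> carrier M" "y \<in> carrier M" "a \<in> carrier R"
    and "x \<oplus>\<^bsub>M\<^esub> (\<ominus>\<^bsub>R\<^esub> a) \<odot>\<^bsub>M\<^esub> y = \<zero>\<^bsub>M\<^esub>"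
  shows "x = a \<odot>\<^bsub>M\<^esub> y"
  using assms by (simp add: smult_l_minus M.minus_equality M.add.inv_unique' M.r_neg M.add.inv_solve_right')

lemma (in module) smult_left_commute:
  "\<lbrakk>a \<in> carrier R; b \<in> carrier R; x \<in> carrier M\<rbrakk>
    \<Longrightarrow> a \<odot>\<^bsub>M\<^esub> (b \<odot>\<^bsub>M\<^esub> x) = b \<odot>\<^bsub>M\<^esub> (a \<odot>\<^bsub>M\<^esub> x)"
  by (simp add: smult_assoc1[symmetric] R.m_comm)

lemma (in module) submodule_zero: "submodule {\<zero>\<^bsub>M\<^esub>} R M"
  unfolding submodule_iff by simp

section \<open>Essential extensions of the residue field\<close>

text \<open>
  Up to isomorphism \<open>E\<close> is an essential extension of \<open>k = R/\<mm>\<close>: the element \<open>e0\<close> generates a copy of \<open>k\<close>, and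
  it lies in every nonzero submodule.
\<close>

locale socle_module = noetherian_local R \<mm> + E: module R E
  for R :: "('a, 'x) ring_scheme" (structure) and \<mm> and E :: "('a, 'e) module" +
  fixes e0
  assumes e0: "e0 \<in> carrier E" "e0 \<noteq> \<zero>\<^bsub>E\<^esub>"
    and m_e0: "a \<in> \<mm> \<Longrightarrow> a \<odot>\<^bsub>E\<^esub> e0 = \<zero>\<^bsub>E\<^esub>"
    and essential: "\<lbrakk>x \<in> carrier E; x \<noteq> \<zero>\<^bsub>E\<^esub>\<rbrakk> \<Longrightarrow> \<exists>a\<in>carrier R. a \<odot>\<^bsub>E\<^esub> x = e0"
begin

text \<open>
  The socle of \<open>E\<close>, the set of elements killed by \<open>\<mm>\<close>, is \<open>k\<close>-spanned by \<open>e0\<close>: if \<open>b y = e0\<close> and \<open>\<mm> y = 0\<close>,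
  then \<open>b\<close> is a unit. So any nonzero element \<open>x\<close> of \<open>E\<close> has all of the socle among its multiples.
\<close>

lemma socle_cyclic:
  assumes x: "x \<in> carrier E" "x \<noteq> \<zero>\<^bsub>E\<^esub>" and y: "y \<in> carrier E"
    and my: "\<And>a. a \<in> \<mm> \<Longrightarrow> a \<odot>\<^bsub>E\<^esub> y = \<zero>\<^bsub>E\<^esub>"
  shows "\<exists>r\<in>carrier R. y = r \<odot>\<^bsub>E\<^esub> x"
proof (cases "y = \<zero>\<^bsub>E\<^esub>")
  case True
  then show ?thesis using x by (intro bexI[of _ \<zero>]) simp_all
next
  case False
  obtain a b where a: "a \<in> carrier R" "a \<odot>\<^bsub>E\<^esub> x = e0" and b: "b \<in> carrier R" "b \<odot>\<^bsub>E\<^esub> y = e0"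
    using essential x y False by metis
  have "b \<notin> \<mm>" using my b e0(2) by auto
  then have u: "b \<in> Units R" using unit b by simp
  have "y = (inv b \<otimes> b) \<odot>\<^bsub>E\<^esub> y" using u y by simp
  also have "\<dots> = inv b \<odot>\<^bsub>E\<^esub> (a \<odot>\<^bsub>E\<^esub> x)"
    using u b y a by (simp add: E.smult_assoc1 del: Units_l_inv)
  also have "\<dots> = (inv b \<otimes> a) \<odot>\<^bsub>E\<^esub> x" using u a x by (simp add: E.smult_assoc1)
  finally show ?thesis using u a by (intro bexI[of _ "inv b \<otimes> a"]) simp_all
qed

text \<open>
  The elements of \<open>E\<close> killed by \<open>\<mm>\<^sup>n\<close>, i.e. the copy of \<open>Hom(R/\<mm>\<^sup>n, E)\<close> in \<open>E\<close>.
\<close>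

definition tor :: "nat \<Rightarrow> 'e set" where
  "tor n = {x \<in> carrier E. \<forall>a\<in>pow_m n. a \<odot>\<^bsub>E\<^esub> x = \<zero>\<^bsub>E\<^esub>}"

lemma tor_0: "tor 0 = {\<zero>\<^bsub>E\<^esub>}"
proof
  show "tor 0 \<subseteq> {\<zero>\<^bsub>E\<^esub>}"
  proof
    fix x assume "x \<in> tor 0"
    then have "x \<in> carrier E" "\<one> \<odot>\<^bsub>E\<^esub> x = \<zero>\<^bsub>E\<^esub>"
      unfolding tor_def pow_m_0 by auto
    then show "x \<in> {\<zero>\<^bsub>E\<^esub>}" by simp
  qed
  show "{\<zero>\<^bsub>E\<^esub>} \<subseteq> tor 0" unfolding tor_def pow_m_0 by auto
qed

lemma tor_submodule: "submodule (tor n) R E"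
  unfolding E.submodule_iff tor_def
proof (safe; (simp add: E.smult_r_distr pow_m_carrier)?)
  fix r x a assume *: "r \<in> carrier R" "x \<in> carrier E" "\<forall>a\<in>pow_m n. a \<odot>\<^bsub>E\<^esub> x = \<zero>\<^bsub>E\<^esub>" "a \<in> pow_m n"
  then have "a \<odot>\<^bsub>E\<^esub> (r \<odot>\<^bsub>E\<^esub> x) = r \<odot>\<^bsub>E\<^esub> (a \<odot>\<^bsub>E\<^esub> x)"
    using pow_m_carrier[OF *(4)] by (intro E.smult_left_commute)
  then show "a \<odot>\<^bsub>E\<^esub> (r \<odot>\<^bsub>E\<^esub> x) = \<zero>\<^bsub>E\<^esub>" using * by simp
qed

lemma tor_mono: "n \<le> k \<Longrightarrow> tor n \<subseteq> tor k"
  using pow_m_antimono[of n k] unfolding tor_def by auto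

lemma m_tor: "\<lbrakk>x \<in> tor (Suc n); a \<in> \<mm>\<rbrakk> \<Longrightarrow> a \<odot>\<^bsub>E\<^esub> x \<in> tor n"
  unfolding tor_def
  using pow_m_mult by (fastforce simp: m_carrier pow_m_carrier E.smult_assoc1[symmetric]
      simp del: nat_pow_Suc)

lemma in_tor_Suc:
  assumes x: "x \<in> carrier E" and "\<And>a. a \<in> \<mm> \<Longrightarrow> a \<odot>\<^bsub>E\<^esub> x \<in> tor n"
  shows "x \<in> tor (Suc n)"
proof -
  have "c \<in> carrier R \<and> c \<odot>\<^bsub>E\<^esub> x = \<zero>\<^bsub>E\<^esub>" if "c \<in> pow_m (Suc n)" for c
    using that[unfolded pow_m_Suc]
  proof (induction rule: ideal_prod.induct)
    case (prod i j)
    then show ?case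
      using assms(2)[OF prod(2)] x by (simp add: m_carrier pow_m_carrier E.smult_assoc1 tor_def)
  next
    case (sum s t)
    then show ?case using x by (simp add: E.smult_l_distr)
  qed
  then show ?thesis using x by (simp add: tor_def)
qed

lemma m_generators: "\<exists>A. finite A \<and> A \<subseteq> \<mm> \<and> (\<forall>I. ideal I R \<longrightarrow> A \<subseteq> I \<longrightarrow> \<mm> \<subseteq> I)"
proof -
  obtain A where A: "A \<subseteq> carrier R" "finite A" "\<mm> = Idl A"
    using noetherian_ring.finetely_gen[OF noetherian ideal_m] by auto
  show ?thesis
    by (rule exI[of _ A]) (simp add: A genideal_self genideal_minimal)
qed

text \<open>
  Every element of \<open>E\<close> is killed by a power of \<open>\<mm>\<close>. Otherwise choose a non-torsion \<open>y\<close> whose annihilator is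
  maximal. As \<open>\<mm>\<close> is finitely generated, some \<open>a y\<close> with \<open>a \<in> \<mm>\<close> is again non-torsion, so \<open>a y\<close> and \<open>y\<close> have
  the same annihilator. But \<open>e0 = b y\<close> for some \<open>b\<close>, and then \<open>b\<close> kills \<open>a y\<close> although it does not
  kill \<open>y\<close>.
\<close>

lemma exists_tor:
  assumes "x \<in> carrier E"
  shows "\<exists>n. x \<in> tor n"
proof (rule ccontr)
  assume "\<nexists>n. x \<in> tor n"
  define ann where "ann y = {a \<in> carrier R. a \<odot>\<^bsub>E\<^esub> y = \<zero>\<^bsub>E\<^esub>}" for y
  define \<A> where "\<A> = {ann y | y. y \<in> carrier E \<and> (\<forall>n. y \<notin> tor n)}"
  have ann_ideal: "ideal (ann y) R" if "y \<in> carrier E" for y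
    using E.colon_ideal[OF E.submodule_zero that] by (simp add: ann_def)
  have "\<A> \<noteq> {}" using assms \<open>\<nexists>n. x \<in> tor n\<close> by (auto simp: \<A>_def)
  then have "\<exists>M\<in>\<A>. \<forall>I\<in>\<A>. M \<subseteq> I \<longrightarrow> I = M"
    by (intro noetherian_ring.ideals_have_maximal[OF noetherian]) (auto simp: \<A>_def ann_ideal)
  then obtain M where "M \<in> \<A>" and M: "\<And>I. \<lbrakk>I \<in> \<A>; M \<subseteq> I\<rbrakk> \<Longrightarrow> I = M" by auto
  then obtain y where y: "y \<in> carrier E" "\<And>n. y \<notin> tor n" and My: "M = ann y"
    by (auto simp: \<A>_def)
  have max: "ann z = ann y" if "z \<in> carrier E" "\<forall>n. z \<notin> tor n" "ann y \<subseteq> ann z" for z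
    using M[of "ann z"] that unfolding My \<A>_def by auto
  obtain A where A: "finite A" "A \<subseteq> \<mm>" "\<And>I. \<lbrakk>ideal I R; A \<subseteq> I\<rbrakk> \<Longrightarrow> \<mm> \<subseteq> I"
    using m_generators by auto
  have "\<exists>a\<in>A. \<forall>n. a \<odot>\<^bsub>E\<^esub> y \<notin> tor n"
  proof (rule ccontr)
    assume "\<not> ?thesis"
    then obtain N where N: "\<And>a. a \<in> A \<Longrightarrow> a \<odot>\<^bsub>E\<^esub> y \<in> tor (N a)" by metis
    define n where "n = (\<Sum>a\<in>A. N a)"
    have "a \<odot>\<^bsub>E\<^esub> y \<in> tor n" if "a \<in> A" for a
      using N[OF that] tor_mono[of "N a" n] member_le_sum[OF that, of N] A(1) by (auto simp: n_def)
    then have "\<mm> \<subseteq> {a \<in> carrier R. a \<odot>\<^bsub>E\<^esub> y \<in> tor n}"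
      using A(2) m_carrier by (intro A(3)[OF E.colon_ideal[OF tor_submodule y(1)]]) auto
    then have "y \<in> tor (Suc n)" by (intro in_tor_Suc[OF y(1)]) auto
    then show False using y(2) by simp
  qed
  then obtain a where a: "a \<in> \<mm>" "\<forall>n. a \<odot>\<^bsub>E\<^esub> y \<notin> tor n" using A(2) by auto
  have ac: "a \<in> carrier R" using a(1) by (rule m_carrier)
  have "ann (a \<odot>\<^bsub>E\<^esub> y) = ann y"
  proof (rule max)
    show "ann y \<subseteq> ann (a \<odot>\<^bsub>E\<^esub> y)"
    proof
      fix b assume "b \<in> ann y"
      then have b: "b \<in> carrier R" "b \<odot>\<^bsub>E\<^esub> y = \<zero>\<^bsub>E\<^esub>" by (simp_all add: ann_def)
      then have "b \<odot>\<^bsub>E\<^esub> (a \<odot>\<^bsub>E\<^esub> y) = a \<odot>\<^bsub>E\<^esub> (b \<odot>\<^bsub>E\<^esub> y)"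
        using ac y(1) by (intro E.smult_left_commute)
      then show "b \<in> ann (a \<odot>\<^bsub>E\<^esub> y)" using b ac by (simp add: ann_def)
    qed
  qed (use ac y(1) a(2) in simp_all)
  moreover have "\<zero>\<^bsub>E\<^esub> \<in> tor 0" by (simp add: tor_0)
  then have "y \<noteq> \<zero>\<^bsub>E\<^esub>" using y(2) by metis
  then obtain b where b: "b \<in> carrier R" "b \<odot>\<^bsub>E\<^esub> y = e0" using essential y(1) by metis
  have "b \<odot>\<^bsub>E\<^esub> (a \<odot>\<^bsub>E\<^esub> y) = a \<odot>\<^bsub>E\<^esub> (b \<odot>\<^bsub>E\<^esub> y)"
    using ac b(1) y(1) by (intro E.smult_left_commute)
  then have "b \<in> ann (a \<odot>\<^bsub>E\<^esub> y)" using b m_e0[OF a(1)] by (simp add: ann_def)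
  ultimately show False using b e0(2) by (simp add: ann_def)
qed

lemma hom_add_smult:
  assumes "f \<in> mod_homs R M E" "g \<in> mod_homs R M E" "r \<in> carrier R"
  shows "(\<lambda>y. f y \<oplus>\<^bsub>E\<^esub> r \<odot>\<^bsub>E\<^esub> g y) \<in> mod_homs R M E"
  using assms unfolding mod_homs_iff
  by (auto simp: E.smult_r_distr E.M.a_ac E.smult_left_commute)

lemma hom_smult:
  assumes "g \<in> mod_homs R M E" "r \<in> carrier R"
  shows "(\<lambda>y. r \<odot>\<^bsub>E\<^esub> g y) \<in> mod_homs R M E"
  using assms unfolding mod_homs_iff
  by (auto simp: E.smult_r_distr E.smult_left_commute)

lemma kernel_submodule:
  assumes Y: "module R Y" and Z: "submodule Z R Y" and g: "g \<in> mod_homs R (Y\<lparr>carrier := Z\<rparr>) E"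
    and W: "submodule W R E"
  shows "submodule {y \<in> Z. g y \<in> W} R Y"
proof -
  interpret Y: module R Y by fact
  interpret ZM: module R "Y\<lparr>carrier := Z\<rparr>"
    using submodule.submodule_is_module[OF Z Y] .
  have "g \<zero>\<^bsub>Y\<^esub> = \<zero>\<^bsub>E\<^esub>"
    using mod_homs_zero[OF ZM.module_axioms E.module_axioms g] by simp
  then show ?thesis
    using Z W g unfolding Y.submodule_iff E.submodule_iff mod_homs_iff by auto
qed

section \<open>Factoring functionals with values in the essential extension\<close>

text \<open>
  Passage from one map \<open>g\<close> to a finite set \<open>G\<close> of maps, by induction on \<open>G\<close>: restricted to the kernel of
  one \<open>g \<in> G\<close>, \<open>f\<close> is a combination \<open>h\<close> of the others, and then \<open>f - h\<close> vanishes on \<open>ker g\<close>, hence is a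
  multiple of \<open>g\<close>. Submodules \<open>Z\<close> of the domain appear because of these restrictions.

  The span of \<open>G\<close> is replaced by any family \<open>L\<close> of maps that contains zero and is closed, up to equality
  on the domain, under adding multiples of members of \<open>G\<close>. Later \<open>L\<close> consists of the multiples of a map,
  of all evaluations at elements of a module, or of a submodule of a dual. The bound \<open>S\<close> on the values of
  the maps in \<open>G\<close> allows the case of one map to be known only for maps into \<open>S\<close>.
\<close>

lemma in_span_if_kernels:
  fixes Y :: "('a, 'y) module"
  assumes Y: "module R Y"
    and factor: "\<And>Z f g. \<lbrakk>submodule Z R Y; f \<in> mod_homs R (Y\<lparr>carrier := Z\<rparr>) E;
        g \<in> mod_homs R (Y\<lparr>carrier := Z\<rparr>) E; \<forall>y\<in>Z. g y \<in> S; \<forall>y\<in>Z. g y = \<zero>\<^bsub>E\<^esub> \<longrightarrow> f y = \<zero>\<^bsub>E\<^esub>\<rbrakk>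
      \<Longrightarrow> \<exists>r\<in>carrier R. \<forall>y\<in>Z. f y = r \<odot>\<^bsub>E\<^esub> g y"
    and L: "\<And>h. h \<in> L \<Longrightarrow> h \<in> mod_homs R (Y\<lparr>carrier := V\<rparr>) E"
    and zero: "\<exists>h\<in>L. \<forall>y\<in>V. h y = \<zero>\<^bsub>E\<^esub>"
    and add: "\<And>h g r. \<lbrakk>h \<in> L; g \<in> G; r \<in> carrier R\<rbrakk>
      \<Longrightarrow> \<exists>h'\<in>L. \<forall>y\<in>V. h' y = h y \<oplus>\<^bsub>E\<^esub> r \<odot>\<^bsub>E\<^esub> g y"
    and fin: "finite G"
    and G: "\<And>g. g \<in> G \<Longrightarrow> g \<in> mod_homs R (Y\<lparr>carrier := V\<rparr>) E"
      "\<And>g y. \<lbrakk>g \<in> G; y \<in> V\<rbrakk> \<Longrightarrow> g y \<in> S"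
    and V: "submodule V R Y" and f: "f \<in> mod_homs R (Y\<lparr>carrier := V\<rparr>) E"
    and ker: "\<And>y. \<lbrakk>y \<in> V; \<forall>g\<in>G. g y = \<zero>\<^bsub>E\<^esub>\<rbrakk> \<Longrightarrow> f y = \<zero>\<^bsub>E\<^esub>"
  shows "\<exists>h\<in>L. \<forall>y\<in>V. f y = h y"
proof -
  have "\<exists>h\<in>L. \<forall>y\<in>Z. f y = h y"
    if "submodule Z R Y" "Z \<subseteq> V" "f \<in> mod_homs R (Y\<lparr>carrier := Z\<rparr>) E"
      "\<forall>y\<in>Z. (\<forall>g\<in>G. g y = \<zero>\<^bsub>E\<^esub>) \<longrightarrow> f y = \<zero>\<^bsub>E\<^esub>" for Z f
    using fin add G that
  proof (induction G arbitrary: Z f rule: finite_induct)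
    case empty
    then show ?case using zero by (metis empty_iff subsetD)
  next
    case (insert g G)
    note Z = insert.prems(4-7)
    have gX: "g \<in> mod_homs R (Y\<lparr>carrier := V\<rparr>) E" using insert.prems(2) by simp
    have g: "g \<in> mod_homs R (Y\<lparr>carrier := Z\<rparr>) E" by (rule mod_homs_restrict[OF gX Z(2)])
    define K where "K = {y \<in> Z. g y \<in> {\<zero>\<^bsub>E\<^esub>}}"
    have K: "submodule K R Y"
      unfolding K_def by (rule kernel_submodule[OF Y Z(1) g E.submodule_zero])
    have KZ: "K \<subseteq> Z" by (auto simp: K_def)
    have "\<exists>h\<in>L. \<forall>y\<in>K. f y = h y"
    proof (rule insert.IH)
      show "K \<subseteq> V" using KZ Z(2) by simp
      show "f \<in> mod_homs R (Y\<lparr>carrier := K\<rparr>) E" by (rule mod_homs_restrict[OF Z(3) KZ])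
      show "\<forall>y\<in>K. (\<forall>g\<in>G. g y = \<zero>\<^bsub>E\<^esub>) \<longrightarrow> f y = \<zero>\<^bsub>E\<^esub>" using Z(4) by (simp add: K_def)
    qed (use K insert.prems(1-3) in simp_all)
    then obtain h where h: "h \<in> L" "\<And>y. y \<in> K \<Longrightarrow> f y = h y" by auto
    have hZ: "h \<in> mod_homs R (Y\<lparr>carrier := Z\<rparr>) E" by (rule mod_homs_restrict[OF L[OF h(1)] Z(2)])
    have cl: "f y \<in> carrier E" "h y \<in> carrier E" "g y \<in> carrier E" if "y \<in> Z" for y
      using Z(3) hZ g that by (simp_all add: mod_homs_iff)
    \<comment> \<open>The difference \<open>f - h\<close>, in the form \<open>f + (-1) h\<close> that \<open>hom_add_smult\<close> covers.\<close>
    define d where "d y = f y \<oplus>\<^bsub>E\<^esub> (\<ominus> \<one>) \<odot>\<^bsub>E\<^esub> h y" for y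
    have "\<exists>r\<in>carrier R. \<forall>y\<in>Z. d y = r \<odot>\<^bsub>E\<^esub> g y"
    proof (rule factor)
      show "d \<in> mod_homs R (Y\<lparr>carrier := Z\<rparr>) E"
        unfolding d_def by (rule hom_add_smult[OF Z(3) hZ]) simp
      show "\<forall>y\<in>Z. g y = \<zero>\<^bsub>E\<^esub> \<longrightarrow> d y = \<zero>\<^bsub>E\<^esub>"
      proof (intro ballI impI)
        fix y assume y: "y \<in> Z" "g y = \<zero>\<^bsub>E\<^esub>"
        then have "f y = h y" using h(2) by (simp add: K_def)
        then show "d y = \<zero>\<^bsub>E\<^esub>" using cl[OF y(1)] by (simp add: d_def E.smult_l_minus E.M.r_neg)
      qed
    qed (use Z g insert.prems(3) in auto)
    then obtain r where r: "r \<in> carrier R" "\<And>y. y \<in> Z \<Longrightarrow> d y = r \<odot>\<^bsub>E\<^esub> g y" by auto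
    obtain h' where h': "h' \<in> L" "\<forall>y\<in>V. h' y = h y \<oplus>\<^bsub>E\<^esub> r \<odot>\<^bsub>E\<^esub> g y"
      using insert.prems(1)[OF h(1) _ r(1), of g] by auto
    have "f y = h' y" if "y \<in> Z" for y
    proof -
      have "f y = h y \<oplus>\<^bsub>E\<^esub> d y"
        using cl[OF that] by (simp add: d_def E.smult_l_minus E.M.a_lcomm E.M.r_neg)
      then show ?thesis using h'(2) r(2)[OF that] that Z(2) by auto
    qed
    then show ?case using h'(1) by auto
  qed
  from this[OF V subset_refl f] ker show ?thesis by simp
qed

text \<open>
  Induction on \<open>n\<close>. Let \<open>K\<close> be the set where \<open>g\<close> takes values in the socle, that is, the common kernel of the
  maps \<open>a g\<close> with \<open>a\<close> in a finite generating set \<open>A\<close> of \<open>\<mm>\<close>. There \<open>f\<close> takes values in the socle as well, and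
  since the socle is one-dimensional, \<open>f = r g\<close> on \<open>K\<close> for some \<open>r\<close>. Then \<open>f - r g\<close> vanishes on \<open>K\<close>, and
  the maps \<open>a g\<close> are killed by one power of \<open>\<mm>\<close> less; so by induction \<open>f - r g\<close> is a combination of them,
  hence a multiple of \<open>g\<close>.
\<close>

lemma factor_torsion:
  fixes Y :: "('a, 'y) module"
  assumes Y: "module R Y" and Z: "submodule Z R Y"
    and f: "f \<in> mod_homs R (Y\<lparr>carrier := Z\<rparr>) E" and g: "g \<in> mod_homs R (Y\<lparr>carrier := Z\<rparr>) E"
    and tor: "\<forall>y\<in>Z. g y \<in> tor n"
    and ker: "\<forall>y\<in>Z. g y = \<zero>\<^bsub>E\<^esub> \<longrightarrow> f y = \<zero>\<^bsub>E\<^esub>"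
  shows "\<exists>r\<in>carrier R. \<forall>y\<in>Z. f y = r \<odot>\<^bsub>E\<^esub> g y"
  using Z f g tor ker
proof (induction n arbitrary: Z f g)
  case 0
  have "\<forall>y\<in>Z. f y = \<zero>\<^bsub>E\<^esub> \<and> g y = \<zero>\<^bsub>E\<^esub>" using 0(4,5) by (simp add: tor_0)
  then show ?case by (intro bexI[of _ \<zero>]) simp_all
next
  case (Suc n)
  interpret Y: module R Y by fact
  note Z = Suc.prems(1) and f = Suc.prems(2) and g = Suc.prems(3) and ker = Suc.prems(5)
  have Zs: "Z \<subseteq> carrier Y" "\<And>x y. \<lbrakk>x \<in> Z; y \<in> Z\<rbrakk> \<Longrightarrow> x \<oplus>\<^bsub>Y\<^esub> y \<in> Z"
      "\<And>a x. \<lbrakk>a \<in> carrier R; x \<in> Z\<rbrakk> \<Longrightarrow> a \<odot>\<^bsub>Y\<^esub> x \<in> Z"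
    using Z unfolding Y.submodule_iff by auto
  have fc: "f y \<in> carrier E" and gc: "g y \<in> carrier E" if "y \<in> Z" for y
    using f g that by (simp_all add: mod_homs_iff)
  obtain A where A: "finite A" "A \<subseteq> \<mm>" "\<And>I. \<lbrakk>ideal I R; A \<subseteq> I\<rbrakk> \<Longrightarrow> \<mm> \<subseteq> I"
    using m_generators by auto
  have Ac: "a \<in> carrier R" if "a \<in> A" for a using A(2) m_carrier that by auto
  define K where "K = {y \<in> Z. \<forall>a\<in>A. a \<odot>\<^bsub>E\<^esub> g y = \<zero>\<^bsub>E\<^esub>}"
  have mK: "a \<odot>\<^bsub>E\<^esub> g y = \<zero>\<^bsub>E\<^esub>" if "y \<in> K" "a \<in> \<mm>" for a y
  proof -
    have y: "y \<in> Z" "\<And>a. a \<in> A \<Longrightarrow> a \<odot>\<^bsub>E\<^esub> g y = \<zero>\<^bsub>E\<^esub>" using that by (simp_all add: K_def)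
    have "\<mm> \<subseteq> {a \<in> carrier R. a \<odot>\<^bsub>E\<^esub> g y \<in> {\<zero>\<^bsub>E\<^esub>}}"
      by (rule A(3)[OF E.colon_ideal[OF E.submodule_zero gc[OF y(1)]]]) (use y Ac in auto)
    then show ?thesis using that(2) by auto
  qed
  have fK: "a \<odot>\<^bsub>E\<^esub> f y = \<zero>\<^bsub>E\<^esub>" if "y \<in> K" "a \<in> \<mm>" for a y
  proof -
    have y: "y \<in> Z" using that(1) by (simp add: K_def)
    have "g (a \<odot>\<^bsub>Y\<^esub> y) = \<zero>\<^bsub>E\<^esub>"
      using mK[OF that] mod_homs_smult[OF g, of a y] m_carrier[OF that(2)] y by simp
    then have "f (a \<odot>\<^bsub>Y\<^esub> y) = \<zero>\<^bsub>E\<^esub>" using ker Zs(3)[OF m_carrier[OF that(2)] y] by simp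
    then show ?thesis using mod_homs_smult[OF f, of a y] m_carrier[OF that(2)] y by simp
  qed
  have "\<exists>r\<in>carrier R. \<forall>y\<in>K. f y = r \<odot>\<^bsub>E\<^esub> g y"
  proof (cases "\<exists>z\<in>K. g z \<noteq> \<zero>\<^bsub>E\<^esub>")
    case False
    then have "\<forall>y\<in>K. g y = \<zero>\<^bsub>E\<^esub> \<and> f y = \<zero>\<^bsub>E\<^esub>" using ker by (auto simp: K_def)
    then show ?thesis by (intro bexI[of _ \<zero>]) simp_all
  next
    case True
    then obtain z where z: "z \<in> K" "g z \<noteq> \<zero>\<^bsub>E\<^esub>" by auto
    then have zZ: "z \<in> Z" by (simp add: K_def)
    obtain r where r: "r \<in> carrier R" "f z = r \<odot>\<^bsub>E\<^esub> g z"
      using socle_cyclic[OF gc[OF zZ] z(2) fc[OF zZ] fK[OF z(1)]] by auto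
    have "f y = r \<odot>\<^bsub>E\<^esub> g y" if y: "y \<in> K" for y
    proof -
      have yZ: "y \<in> Z" using y by (simp add: K_def)
      obtain b where b: "b \<in> carrier R" "g y = b \<odot>\<^bsub>E\<^esub> g z"
        using socle_cyclic[OF gc[OF zZ] z(2) gc[OF yZ] mK[OF y]] by auto
      \<comment> \<open>\<open>w = y - b z\<close> is killed by \<open>g\<close>, so \<open>f\<close> kills it as well.\<close>
      define w where "w = y \<oplus>\<^bsub>Y\<^esub> (\<ominus> b) \<odot>\<^bsub>Y\<^esub> z"
      have w: "h w = h y \<oplus>\<^bsub>E\<^esub> (\<ominus> b) \<odot>\<^bsub>E\<^esub> h z" if "h \<in> mod_homs R (Y\<lparr>carrier := Z\<rparr>) E" for h
        using mod_homs_add[OF that, of y "(\<ominus> b) \<odot>\<^bsub>Y\<^esub> z"] mod_homs_smult[OF that, of "\<ominus> b" z]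
          yZ zZ b(1) Zs(3) by (simp add: w_def)
      have "g w = \<zero>\<^bsub>E\<^esub>"
        using w[OF g] b gc[OF zZ] by (simp add: E.smult_l_minus E.M.r_neg)
      moreover have "w \<in> Z" unfolding w_def using yZ zZ b(1) Zs(2,3) by simp
      ultimately have "f y \<oplus>\<^bsub>E\<^esub> (\<ominus> b) \<odot>\<^bsub>E\<^esub> f z = \<zero>\<^bsub>E\<^esub>" using ker w[OF f] by simp
      then have "f y = b \<odot>\<^bsub>E\<^esub> f z" by (rule E.eq_smult_if_diff_zero[OF fc[OF yZ] fc[OF zZ] b(1)])
      then show ?thesis using r b gc[OF zZ] by (simp add: E.smult_left_commute)
    qed
    then show ?thesis using r(1) by auto
  qed
  then obtain r where r: "r \<in> carrier R" "\<And>y. y \<in> K \<Longrightarrow> f y = r \<odot>\<^bsub>E\<^esub> g y" by auto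
  define d where "d y = f y \<oplus>\<^bsub>E\<^esub> (\<ominus> r) \<odot>\<^bsub>E\<^esub> g y" for y
  have "\<exists>h\<in>{\<lambda>y. c \<odot>\<^bsub>E\<^esub> g y | c. c \<in> carrier R}. \<forall>y\<in>Z. d y = h y"
  proof (rule in_span_if_kernels[OF Y, where S = "tor n" and G = "(\<lambda>a y. a \<odot>\<^bsub>E\<^esub> g y) ` A"])
    show "d \<in> mod_homs R (Y\<lparr>carrier := Z\<rparr>) E"
      unfolding d_def by (rule hom_add_smult[OF f g]) (use r in simp)
    show "h \<in> mod_homs R (Y\<lparr>carrier := Z\<rparr>) E" if "h \<in> {\<lambda>y. c \<odot>\<^bsub>E\<^esub> g y | c. c \<in> carrier R}" for h
      using that hom_smult[OF g] by auto
    show "\<exists>h\<in>{\<lambda>y. c \<odot>\<^bsub>E\<^esub> g y | c. c \<in> carrier R}. \<forall>y\<in>Z. h y = \<zero>\<^bsub>E\<^esub>"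
      using gc by (intro bexI[of _ "\<lambda>y. \<zero> \<odot>\<^bsub>E\<^esub> g y"]) auto
    show "h \<in> mod_homs R (Y\<lparr>carrier := Z\<rparr>) E" if "h \<in> (\<lambda>a y. a \<odot>\<^bsub>E\<^esub> g y) ` A" for h
      using that hom_smult[OF g] Ac by auto
    show "h y \<in> tor n" if "h \<in> (\<lambda>a y. a \<odot>\<^bsub>E\<^esub> g y) ` A" "y \<in> Z" for h y
      using that m_tor Suc.prems(4) A(2) by auto
    show "\<exists>h'\<in>{\<lambda>y. c \<odot>\<^bsub>E\<^esub> g y | c. c \<in> carrier R}. \<forall>y\<in>Z. h' y = h y \<oplus>\<^bsub>E\<^esub> s \<odot>\<^bsub>E\<^esub> k y"
      if h: "h \<in> {\<lambda>y. c \<odot>\<^bsub>E\<^esub> g y | c. c \<in> carrier R}" and k: "k \<in> (\<lambda>a y. a \<odot>\<^bsub>E\<^esub> g y) ` A"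
        and s: "s \<in> carrier R" for h k s
    proof -
      obtain c a where c: "c \<in> carrier R" "h = (\<lambda>y. c \<odot>\<^bsub>E\<^esub> g y)"
        and a: "a \<in> carrier R" "k = (\<lambda>y. a \<odot>\<^bsub>E\<^esub> g y)" using h k Ac by auto
      have "\<forall>y\<in>Z. (c \<oplus> s \<otimes> a) \<odot>\<^bsub>E\<^esub> g y = h y \<oplus>\<^bsub>E\<^esub> s \<odot>\<^bsub>E\<^esub> k y"
        using gc c a s by (simp add: E.smult_l_distr E.smult_assoc1)
      then show ?thesis using c(1) a(1) s
        by (intro bexI[of _ "\<lambda>y. (c \<oplus> s \<otimes> a) \<odot>\<^bsub>E\<^esub> g y"]) auto
    qed
    show "d y = \<zero>\<^bsub>E\<^esub>" if "y \<in> Z" "\<forall>k\<in>(\<lambda>a y. a \<odot>\<^bsub>E\<^esub> g y) ` A. k y = \<zero>\<^bsub>E\<^esub>" for y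
    proof -
      have "y \<in> K" using that by (simp add: K_def)
      then show ?thesis using r gc[OF that(1)]
        by (simp add: d_def E.smult_l_minus E.M.r_neg)
    qed
  qed (use A(1) Z Suc.IH in simp_all)
  then obtain c where c: "c \<in> carrier R" "\<And>y. y \<in> Z \<Longrightarrow> d y = c \<odot>\<^bsub>E\<^esub> g y" by auto
  have "f y = (r \<oplus> c) \<odot>\<^bsub>E\<^esub> g y" if "y \<in> Z" for y
  proof -
    have "f y = r \<odot>\<^bsub>E\<^esub> g y \<oplus>\<^bsub>E\<^esub> d y"
      using fc[OF that] gc[OF that] r(1)
      by (simp add: d_def E.smult_l_minus E.M.a_lcomm E.M.r_neg)
    then show ?thesis using c gc[OF that] r(1) that by (simp add: E.smult_l_distr)
  qed
  then show ?case using c(1) r(1) by (intro bexI[of _ "r \<oplus> c"]) auto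
qed

end

locale complete_socle_module = socle_module +
  assumes complete: "adically_complete R \<mm>"
begin

lemma pow_m_tor: "\<lbrakk>x \<in> tor n; a \<in> pow_m n\<rbrakk> \<Longrightarrow> a \<odot>\<^bsub>E\<^esub> x = \<zero>\<^bsub>E\<^esub>"
  by (simp add: tor_def)

lemma smult_eq_if_diff:
  assumes "a \<in> carrier R" "b \<in> carrier R" "x \<in> carrier E" "(a \<ominus> b) \<odot>\<^bsub>E\<^esub> x = \<zero>\<^bsub>E\<^esub>"
  shows "a \<odot>\<^bsub>E\<^esub> x = b \<odot>\<^bsub>E\<^esub> x"
proof (rule E.eq_smult_if_diff_zero)
  show "a \<odot>\<^bsub>E\<^esub> x \<oplus>\<^bsub>E\<^esub> \<ominus> b \<odot>\<^bsub>E\<^esub> x = \<zero>\<^bsub>E\<^esub>"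
    using assms by (simp add: a_minus_def E.smult_l_distr)
qed (use assms in simp_all)

text \<open>
  Let \<open>D n\<close> be the part of the domain where \<open>g\<close> is killed by \<open>\<mm>\<^sup>n\<close>, \<open>r n\<close> a scalar with \<open>f = r n g\<close> on \<open>D n\<close>,
  and \<open>N n\<close> the ideal of those scalars that kill \<open>g\<close> on \<open>D n\<close>. The admissible scalars on \<open>D n\<close> form the coset
  \<open>r n + N n\<close>, and the task is to find a common element of these decreasing cosets. Along a subsequence \<open>d\<close>
  for which \<open>N (d k)\<close> and \<open>N (d (k+1))\<close> agree modulo \<open>\<mm>\<^sup>k\<close>, an admissible scalar for \<open>D (d k)\<close> can be
  changed by an element of \<open>\<mm>\<^sup>k\<close> into one for \<open>D (d (k+1))\<close>. The limit of the resulting sequence is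
  admissible everywhere, because \<open>\<mm>\<^sup>k\<close> acts as zero on the values of \<open>g\<close> on \<open>D k\<close>.
\<close>

lemma factor_through:
  fixes Y :: "('a, 'y) module"
  assumes Y: "module R Y" and Z: "submodule Z R Y"
    and f: "f \<in> mod_homs R (Y\<lparr>carrier := Z\<rparr>) E" and g: "g \<in> mod_homs R (Y\<lparr>carrier := Z\<rparr>) E"
    and ker: "\<forall>y\<in>Z. g y = \<zero>\<^bsub>E\<^esub> \<longrightarrow> f y = \<zero>\<^bsub>E\<^esub>"
  shows "\<exists>r\<in>carrier R. \<forall>y\<in>Z. f y = r \<odot>\<^bsub>E\<^esub> g y"
proof -
  have gc: "g y \<in> carrier E" if "y \<in> Z" for y
    using g that by (simp add: mod_homs_iff)
  define D where "D n = {y \<in> Z. g y \<in> tor n}" for n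
  have D: "submodule (D n) R Y" "D n \<subseteq> Z" for n
    unfolding D_def by (rule kernel_submodule[OF Y Z g tor_submodule]) auto
  have Dmono: "D n \<subseteq> D k" if "n \<le> k" for n k using tor_mono[OF that] by (auto simp: D_def)
  have "\<exists>r\<in>carrier R. \<forall>y\<in>D n. f y = r \<odot>\<^bsub>E\<^esub> g y" for n
    by (rule factor_torsion[OF Y D(1) mod_homs_restrict[OF f D(2)] mod_homs_restrict[OF g D(2)]])
      (use ker in \<open>auto simp: D_def\<close>)
  then obtain r where r: "\<And>n. r n \<in> carrier R" "\<And>n y. y \<in> D n \<Longrightarrow> f y = r n \<odot>\<^bsub>E\<^esub> g y"
    by metis
  define N where "N n = {a \<in> carrier R. \<forall>y\<in>D n. a \<odot>\<^bsub>E\<^esub> g y = \<zero>\<^bsub>E\<^esub>}" for n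
  have N_ideal: "ideal (N n) R" for n
  proof (rule idealI[OF ring_axioms])
    show "subgroup (N n) (add_monoid R)"
    proof (rule add.subgroupI)
      have "\<zero> \<in> N n" using gc D(2) by (auto simp: N_def subset_iff)
      then show "N n \<noteq> {}" by auto
    qed (use gc D(2) in \<open>auto simp: N_def E.smult_l_distr E.smult_l_minus subset_iff\<close>)
    fix a b assume ab: "a \<in> N n" "b \<in> carrier R"
    then show "b \<otimes> a \<in> N n" using gc D(2) by (auto simp: N_def E.smult_assoc1 subset_iff)
    then show "a \<otimes> b \<in> N n" using ab by (simp add: N_def m_comm)
  qed
  have Nanti: "N (Suc n) \<subseteq> N n" for n using Dmono[of n "Suc n"] by (auto simp: N_def)
  have "\<exists>c. \<forall>n\<ge>c. N n <+>\<^bsub>R\<^esub> pow_m k = N c <+>\<^bsub>R\<^esub> pow_m k" for k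
    using stabilising_pow_m[of k, unfolded stabilising_def, rule_format, of "\<lambda>n. N n <+>\<^bsub>R\<^esub> pow_m k"]
      add_ideals[OF N_ideal ideal_pow_m] set_add_subset_right[OF N_ideal ideal_pow_m]
      set_add_mono_left[OF Nanti] by simp
  then obtain c where c: "\<And>k n. n \<ge> c k \<Longrightarrow> N n <+>\<^bsub>R\<^esub> pow_m k = N (c k) <+>\<^bsub>R\<^esub> pow_m k"
    by metis
  \<comment> \<open>The summand \<open>k\<close> makes \<open>D k \<subseteq> D (d k)\<close>; the sum makes \<open>d\<close> increasing and at least \<open>c\<close>.\<close>
  define d where "d k = k + (\<Sum>j\<le>k. c j)" for k
  have d: "k \<le> d k" "c k \<le> d k" "d k \<le> d (Suc k)" for k
    using member_le_sum[of k "{..k}" c] by (auto simp: d_def)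
  have dN: "N (d k) <+>\<^bsub>R\<^esub> pow_m k = N (d (Suc k)) <+>\<^bsub>R\<^esub> pow_m k" for k
    using c[of k "d k"] c[of k "d (Suc k)"] d(2,3)[of k] by simp
  define S where "S k = {s \<in> carrier R. \<forall>y\<in>D (d k). f y = s \<odot>\<^bsub>E\<^esub> g y}" for k
  \<comment> \<open>Write \<open>r - x = u + v\<close> with \<open>u \<in> N (d (Suc k))\<close> and \<open>v \<in> \<mm>\<^sup>k\<close>, where \<open>r\<close> is admissible at stage
    \<open>Suc k\<close>: then \<open>x + v = r - u\<close> is admissible at that stage and congruent to \<open>x\<close> modulo \<open>\<mm>\<^sup>k\<close>.\<close>
  have "\<exists>x. \<forall>k. x k \<in> S k \<and> x (Suc k) \<ominus> x k \<in> pow_m k"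
  proof (rule dependent_nat_choice)
    show "\<exists>x. x \<in> S 0" using r by (auto simp: S_def)
    fix x k assume x: "x \<in> S k"
    then have xR: "x \<in> carrier R" by (simp add: S_def)
    let ?r = "r (d (Suc k))"
    have "?r \<ominus> x \<in> N (d k)"
    proof -
      have "(?r \<ominus> x) \<odot>\<^bsub>E\<^esub> g y = \<zero>\<^bsub>E\<^esub>" if y: "y \<in> D (d k)" for y
      proof -
        have "y \<in> D (d (Suc k))" using y Dmono[OF d(3)] by auto
        then have "f y = ?r \<odot>\<^bsub>E\<^esub> g y" by (rule r(2))
        moreover have "f y = x \<odot>\<^bsub>E\<^esub> g y" using x y by (simp add: S_def)
        ultimately have "?r \<odot>\<^bsub>E\<^esub> g y = x \<odot>\<^bsub>E\<^esub> g y" by simp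
        then show ?thesis using gc[of y] y D(2)[of "d k"] xR r(1)
          by (auto simp: a_minus_def E.smult_l_distr E.smult_l_minus E.M.r_neg)
      qed
      then show ?thesis using xR r(1) by (simp add: N_def)
    qed
    then have "?r \<ominus> x \<in> N (d (Suc k)) <+>\<^bsub>R\<^esub> pow_m k"
      using set_add_subset_left[OF N_ideal ideal_pow_m, of "d k" k] unfolding dN by (rule subsetD[rotated])
    then obtain u v where u: "u \<in> N (d (Suc k))" and v: "v \<in> pow_m k" and eq: "?r \<ominus> x = u \<oplus> v"
      unfolding in_set_add by auto
    have uR: "u \<in> carrier R" and vR: "v \<in> carrier R"
      using u pow_m_carrier[OF v] by (simp_all add: N_def)
    have "x \<oplus> v \<in> S (Suc k)"
    proof -
      have "f y = (x \<oplus> v) \<odot>\<^bsub>E\<^esub> g y" if y: "y \<in> D (d (Suc k))" for y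
      proof -
        have "?r \<ominus> (x \<oplus> v) = (?r \<ominus> x) \<ominus> v" using xR vR r(1) by algebra
        also have "\<dots> = u" unfolding eq using uR vR by algebra
        finally have "(?r \<ominus> (x \<oplus> v)) \<odot>\<^bsub>E\<^esub> g y = \<zero>\<^bsub>E\<^esub>" using u y by (simp add: N_def)
        then have "?r \<odot>\<^bsub>E\<^esub> g y = (x \<oplus> v) \<odot>\<^bsub>E\<^esub> g y"
          using xR vR r(1) gc[of y] y D(2) by (intro smult_eq_if_diff) auto
        then show ?thesis using r(2)[OF y] by simp
      qed
      then show ?thesis using xR vR by (simp add: S_def)
    qed
    moreover have "(x \<oplus> v) \<ominus> x = v" using xR vR by algebra
    ultimately show "\<exists>x'. x' \<in> S (Suc k) \<and> x' \<ominus> x \<in> pow_m k" using v by metis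
  qed
  then obtain x where x: "\<And>k. x k \<in> S k" "\<And>k. x (Suc k) \<ominus> x k \<in> pow_m k" by auto
  have xR: "x k \<in> carrier R" for k using x(1)[of k] by (simp add: S_def)
  obtain s where s: "s \<in> carrier R" "\<And>n. s \<ominus> x n \<in> pow_m n"
    using complete[unfolded adically_complete_def, rule_format, of x] x(2) xR by auto
  have "f y = s \<odot>\<^bsub>E\<^esub> g y" if y: "y \<in> Z" for y
  proof -
    obtain k where k: "g y \<in> tor k" using exists_tor[OF gc[OF y]] by auto
    then have "y \<in> D (d k)" using y tor_mono[OF d(1)] by (auto simp: D_def)
    then have "f y = x k \<odot>\<^bsub>E\<^esub> g y" using x(1)[of k] by (simp add: S_def)
    moreover have "s \<odot>\<^bsub>E\<^esub> g y = x k \<odot>\<^bsub>E\<^esub> g y"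
      by (rule smult_eq_if_diff[OF s(1) xR gc[OF y] pow_m_tor[OF k s(2)]])
    ultimately show ?thesis by simp
  qed
  then show ?thesis using s(1) by auto
qed

end

section \<open>Separation of elements from submodules\<close>

context socle_module
begin

text \<open>
  \<open>E\<close> is a cogenerator: \<open>(C + Rx)/C\<close> is cyclic and nonzero, isomorphic to \<open>R/I\<close> with \<open>I \<subseteq> \<mm>\<close>, hence maps onto
  \<open>k\<close>, with \<open>x\<close> going to \<open>e0\<close>. The functional lives on \<open>Z = C + Rx\<close>.
\<close>

lemma separating_functional:
  fixes Y :: "('a, 'y) module"
  assumes Y: "module R Y" and C: "submodule C R Y" and x: "x \<in> carrier Y" "x \<notin> C"
  shows "\<exists>Z \<phi>. submodule Z R Y \<and> C \<subseteq> Z \<and> x \<in> Z \<and> \<phi> \<in> mod_homs R (Y\<lparr>carrier := Z\<rparr>) E \<and>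
    (\<forall>c\<in>C. \<phi> c = \<zero>\<^bsub>E\<^esub>) \<and> \<phi> x = e0"
proof -
  interpret Y: module R Y by fact
  note Cs = C[unfolded Y.submodule_iff]
  have Cc: "c \<in> carrier Y" if "c \<in> C" for c using Cs that by auto
  have Cd: "c \<ominus>\<^bsub>Y\<^esub> c' \<in> C" if "c \<in> C" "c' \<in> C" for c c'
    using that Cs Y.submoduleE(3)[OF C] by (simp add: a_minus_def)
  have colon: "a \<in> \<mm>" if a: "a \<in> carrier R" "a \<odot>\<^bsub>Y\<^esub> x \<in> C" for a
  proof (rule ccontr)
    assume "a \<notin> \<mm>"
    then have u: "a \<in> Units R" using unit a by simp
    then have "inv a \<odot>\<^bsub>Y\<^esub> (a \<odot>\<^bsub>Y\<^esub> x) \<in> C" using Cs a by simp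
    then show False using u a(1) x by (simp add: Y.smult_assoc1[symmetric])
  qed
  define Z where "Z = {c \<oplus>\<^bsub>Y\<^esub> a \<odot>\<^bsub>Y\<^esub> x | c a. c \<in> C \<and> a \<in> carrier R}"
  define \<phi> where "\<phi> z = (SOME a. a \<in> carrier R \<and> (\<exists>c\<in>C. z = c \<oplus>\<^bsub>Y\<^esub> a \<odot>\<^bsub>Y\<^esub> x)) \<odot>\<^bsub>E\<^esub> e0" for z
  have ZI: "c \<oplus>\<^bsub>Y\<^esub> a \<odot>\<^bsub>Y\<^esub> x \<in> Z" if "c \<in> C" "a \<in> carrier R" for c a
    unfolding Z_def using that by auto
  have val: "\<phi> (c \<oplus>\<^bsub>Y\<^esub> a \<odot>\<^bsub>Y\<^esub> x) = a \<odot>\<^bsub>E\<^esub> e0" if c: "c \<in> C" and a: "a \<in> carrier R" for c a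
  proof -
    define b where
      "b = (SOME b. b \<in> carrier R \<and> (\<exists>c'\<in>C. c \<oplus>\<^bsub>Y\<^esub> a \<odot>\<^bsub>Y\<^esub> x = c' \<oplus>\<^bsub>Y\<^esub> b \<odot>\<^bsub>Y\<^esub> x))"
    have "b \<in> carrier R \<and> (\<exists>c'\<in>C. c \<oplus>\<^bsub>Y\<^esub> a \<odot>\<^bsub>Y\<^esub> x = c' \<oplus>\<^bsub>Y\<^esub> b \<odot>\<^bsub>Y\<^esub> x)"
      unfolding b_def by (rule someI[of _ a]) (use that in auto)
    then obtain c' where b: "b \<in> carrier R" and c': "c' \<in> C"
      and eq: "c \<oplus>\<^bsub>Y\<^esub> a \<odot>\<^bsub>Y\<^esub> x = c' \<oplus>\<^bsub>Y\<^esub> b \<odot>\<^bsub>Y\<^esub> x" by auto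
    have "(a \<ominus> b) \<odot>\<^bsub>Y\<^esub> x = c' \<ominus>\<^bsub>Y\<^esub> c"
    proof -
      have "(a \<ominus> b) \<odot>\<^bsub>Y\<^esub> x = (c \<oplus>\<^bsub>Y\<^esub> a \<odot>\<^bsub>Y\<^esub> x) \<oplus>\<^bsub>Y\<^esub> (\<ominus>\<^bsub>Y\<^esub> c \<oplus>\<^bsub>Y\<^esub> \<ominus>\<^bsub>Y\<^esub> (b \<odot>\<^bsub>Y\<^esub> x))"
        using a b x(1) Cc[OF c]
        by (simp add: a_minus_def Y.smult_l_distr Y.smult_l_minus Y.M.a_ac Y.M.r_neg1 Y.M.r_neg2 Y.M.r_neg)
      also have "\<dots> = c' \<ominus>\<^bsub>Y\<^esub> c"
        unfolding eq using a b x(1) Cc[OF c] Cc[OF c']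
        by (simp add: a_minus_def Y.M.a_ac Y.M.r_neg1 Y.M.r_neg2 Y.M.r_neg)
      finally show ?thesis .
    qed
    then have "a \<ominus> b \<in> \<mm>" using colon[of "a \<ominus> b"] Cd[OF c' c] a b by simp
    then have "(a \<ominus> b) \<odot>\<^bsub>E\<^esub> e0 = \<zero>\<^bsub>E\<^esub>" by (rule m_e0)
    then have "a \<odot>\<^bsub>E\<^esub> e0 = b \<odot>\<^bsub>E\<^esub> e0"
      using a b e0(1) by (intro E.eq_smult_if_diff_zero) (simp_all add: a_minus_def E.smult_l_distr)
    then show ?thesis by (simp add: \<phi>_def b_def)
  qed
  have sums: "(c \<oplus>\<^bsub>Y\<^esub> a \<odot>\<^bsub>Y\<^esub> x) \<oplus>\<^bsub>Y\<^esub> (c' \<oplus>\<^bsub>Y\<^esub> a' \<odot>\<^bsub>Y\<^esub> x) = (c \<oplus>\<^bsub>Y\<^esub> c') \<oplus>\<^bsub>Y\<^esub> (a \<oplus> a') \<odot>\<^bsub>Y\<^esub> x"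
    if "c \<in> C" "c' \<in> C" "a \<in> carrier R" "a' \<in> carrier R" for c c' a a'
    using that Cc x by (simp add: Y.smult_l_distr Y.M.a_ac)
  have mults: "r \<odot>\<^bsub>Y\<^esub> (c \<oplus>\<^bsub>Y\<^esub> a \<odot>\<^bsub>Y\<^esub> x) = (r \<odot>\<^bsub>Y\<^esub> c) \<oplus>\<^bsub>Y\<^esub> (r \<otimes> a) \<odot>\<^bsub>Y\<^esub> x"
    if "c \<in> C" "a \<in> carrier R" "r \<in> carrier R" for c a r
    using that Cc x by (simp add: Y.smult_r_distr Y.smult_assoc1)
  have CZ: "c = c \<oplus>\<^bsub>Y\<^esub> \<zero> \<odot>\<^bsub>Y\<^esub> x" if "c \<in> C" for c using Cc[OF that] x(1) by simp
  have xZ: "x = \<zero>\<^bsub>Y\<^esub> \<oplus>\<^bsub>Y\<^esub> \<one> \<odot>\<^bsub>Y\<^esub> x" using x(1) by simp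
  have "submodule Z R Y"
    unfolding Y.submodule_iff
  proof (intro conjI ballI)
    show "Z \<subseteq> carrier Y" using Cc x(1) by (auto simp: Z_def)
    show "\<zero>\<^bsub>Y\<^esub> \<in> Z" using CZ[of "\<zero>\<^bsub>Y\<^esub>"] ZI[of "\<zero>\<^bsub>Y\<^esub>" \<zero>] Cs by simp
    show "u \<oplus>\<^bsub>Y\<^esub> v \<in> Z" if uv: "u \<in> Z" "v \<in> Z" for u v
    proof -
      obtain c a c' a' where "c \<in> C" "a \<in> carrier R" "u = c \<oplus>\<^bsub>Y\<^esub> a \<odot>\<^bsub>Y\<^esub> x"
        and "c' \<in> C" "a' \<in> carrier R" "v = c' \<oplus>\<^bsub>Y\<^esub> a' \<odot>\<^bsub>Y\<^esub> x" using uv by (auto simp: Z_def)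
      then show ?thesis using sums ZI Cs by simp
    qed
    show "r \<odot>\<^bsub>Y\<^esub> u \<in> Z" if "r \<in> carrier R" "u \<in> Z" for r u
      using that mults ZI Cs by (auto simp: Z_def)
  qed
  moreover have "\<phi> \<in> mod_homs R (Y\<lparr>carrier := Z\<rparr>) E"
    unfolding mod_homs_iff
  proof (intro conjI ballI)
    fix u assume "u \<in> carrier (Y\<lparr>carrier := Z\<rparr>)"
    then obtain c a where u: "c \<in> C" "a \<in> carrier R" "u = c \<oplus>\<^bsub>Y\<^esub> a \<odot>\<^bsub>Y\<^esub> x" by (auto simp: Z_def)
    then show "\<phi> u \<in> carrier E" using val e0(1) by simp
    show "\<phi> (r \<odot>\<^bsub>Y\<lparr>carrier := Z\<rparr>\<^esub> u) = r \<odot>\<^bsub>E\<^esub> \<phi> u" if "r \<in> carrier R" for r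
      using u that e0(1) Cs by (simp add: mults val E.smult_assoc1)
    fix v assume "v \<in> carrier (Y\<lparr>carrier := Z\<rparr>)"
    then obtain c' a' where v: "c' \<in> C" "a' \<in> carrier R" "v = c' \<oplus>\<^bsub>Y\<^esub> a' \<odot>\<^bsub>Y\<^esub> x" by (auto simp: Z_def)
    show "\<phi> (u \<oplus>\<^bsub>Y\<lparr>carrier := Z\<rparr>\<^esub> v) = \<phi> u \<oplus>\<^bsub>E\<^esub> \<phi> v"
      using u v e0(1) Cs by (simp add: sums val E.smult_l_distr)
  qed
  moreover have "\<phi> c = \<zero>\<^bsub>E\<^esub>" "c \<in> Z" if "c \<in> C" for c
    using val[OF that zero_closed] ZI[OF that zero_closed] CZ[OF that] e0(1) by simp_all
  moreover have "\<phi> x = e0" "x \<in> Z"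
    using val[of "\<zero>\<^bsub>Y\<^esub>" \<one>] ZI[of "\<zero>\<^bsub>Y\<^esub>" \<one>] xZ e0(1) Cs by simp_all
  ultimately show ?thesis by (intro exI[of _ Z] exI[of _ \<phi>]) auto
qed

end

section \<open>The Matlis dual\<close>

text \<open>
  Stated through the submodules containing the generators, so that a property closed under the module
  operations passes from the generators to the whole module.
\<close>

definition finitely_generated :: "('r, 'x) ring_scheme \<Rightarrow> ('r, 'm) module \<Rightarrow> bool" where
  "finitely_generated R M \<longleftrightarrow> (\<exists>F. finite F \<and> F \<subseteq> carrier M \<and>
     (\<forall>N. submodule N R M \<longrightarrow> F \<subseteq> N \<longrightarrow> carrier M \<subseteq> N))"

text \<open>
  Otherwise, repeatedly adjoining an element outside the submodule generated so far would produce an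
  ascending chain that does not stabilise.
\<close>

lemma noetherian_finitely_generated:
  assumes "noetherian_module R M"
  shows "finitely_generated R M"
proof (rule ccontr)
  assume nfg: "\<not> finitely_generated R M"
  interpret module R M using assms by (simp add: noetherian_module_def)
  define span where "span F = \<Inter>{N. submodule N R M \<and> F \<subseteq> N}" for F
  have span_sub: "submodule (span F) R M" if "F \<subseteq> carrier M" for F
  proof -
    have "carrier M \<in> {N. submodule N R M \<and> F \<subseteq> N}" using that carrier_is_submodule by simp
    then show ?thesis unfolding span_def submodule_iff by auto
  qed
  have span_mono: "F \<subseteq> G \<Longrightarrow> span F \<subseteq> span G" for F G unfolding span_def by auto
  have span_self: "F \<subseteq> span F" for F unfolding span_def by auto
  have grow: "\<exists>x\<in>carrier M. x \<notin> span F" if F: "finite F" "F \<subseteq> carrier M" for F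
  proof -
    obtain N where "submodule N R M" "F \<subseteq> N" "\<not> carrier M \<subseteq> N"
      using nfg F unfolding finitely_generated_def by metis
    then show ?thesis unfolding span_def by auto
  qed
  have "\<exists>F. \<forall>n. (finite (F n) \<and> F n \<subseteq> carrier M) \<and> F n \<subseteq> F (Suc n) \<and> \<not> F (Suc n) \<subseteq> span (F n)"
  proof (rule dependent_nat_choice)
    show "\<exists>F. finite F \<and> F \<subseteq> carrier M" by (rule exI[of _ "{}"]) simp
    fix F and n :: nat assume F: "finite F \<and> F \<subseteq> carrier M"
    then obtain x where "x \<in> carrier M" "x \<notin> span F" using grow by auto
    then show "\<exists>G. (finite G \<and> G \<subseteq> carrier M) \<and> F \<subseteq> G \<and> \<not> G \<subseteq> span F"
      using F by (intro exI[of _ "insert x F"]) auto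
  qed
  then obtain F where F: "\<And>n. finite (F n)" "\<And>n. F n \<subseteq> carrier M" "\<And>n. F n \<subseteq> F (Suc n)"
    "\<And>n. \<not> F (Suc n) \<subseteq> span (F n)" by auto
  have "\<exists>n. \<forall>k\<ge>n. span (F k) = span (F n)"
    using assms[unfolded noetherian_module_def, THEN conjunct2, rule_format, of "\<lambda>n. span (F n)"]
      span_sub[OF F(2)] span_mono[OF F(3)] by simp
  then obtain n where "span (F (Suc n)) = span (F n)" by (metis le_SucI order_refl)
  then show False using F(4)[of n] span_self[of "F (Suc n)"] by simp
qed

lemma dual_carrier:
  "f \<in> carrier (dual R E M) \<longleftrightarrow> f \<in> mod_homs R M E \<and> f \<in> extensional (carrier M)"
  by (simp add: dual_def)

lemma dual_simps:
  "\<zero>\<^bsub>dual R E M\<^esub> = (\<lambda>x\<in>carrier M. \<zero>\<^bsub>E\<^esub>)"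
  "f \<oplus>\<^bsub>dual R E M\<^esub> g = (\<lambda>x\<in>carrier M. f x \<oplus>\<^bsub>E\<^esub> g x)"
  "r \<odot>\<^bsub>dual R E M\<^esub> f = (\<lambda>x\<in>carrier M. r \<odot>\<^bsub>E\<^esub> f x)"
  by (simp_all add: dual_def)

lemma dual_restrict:
  assumes "module R M" "f \<in> mod_homs R M E"
  shows "restrict f (carrier M) \<in> carrier (dual R E M)"
proof -
  interpret M: module R M by fact
  show ?thesis using assms(2) unfolding dual_carrier mod_homs_iff by simp
qed

lemma dual_eqI:
  "\<lbrakk>f \<in> carrier (dual R E M); g \<in> carrier (dual R E M); \<And>x. x \<in> carrier M \<Longrightarrow> f x = g x\<rbrakk> \<Longrightarrow> f = g"
  unfolding dual_carrier by (blast intro: extensionalityI)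

lemma module_dual:
  assumes "module R E" "module R M"
  shows "module R (dual R E M)"
proof -
  interpret E: module R E by fact
  interpret M: module R M by fact
  have cl: "f x \<in> carrier E" if "f \<in> carrier (dual R E M)" "x \<in> carrier M" for f x
    using that by (simp add: dual_carrier mod_homs_iff)
  have add: "f \<oplus>\<^bsub>dual R E M\<^esub> g \<in> carrier (dual R E M)"
    if "f \<in> carrier (dual R E M)" "g \<in> carrier (dual R E M)" for f g
    using that by (simp add: dual_carrier mod_homs_iff dual_simps E.smult_r_distr E.M.a_ac)
  have smult: "r \<odot>\<^bsub>dual R E M\<^esub> f \<in> carrier (dual R E M)"
    if "r \<in> carrier R" "f \<in> carrier (dual R E M)" for r f
    using that by (simp add: dual_carrier mod_homs_iff dual_simps E.smult_r_distr E.smult_left_commute)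
  have zero: "\<zero>\<^bsub>dual R E M\<^esub> \<in> carrier (dual R E M)"
    by (simp add: dual_carrier mod_homs_iff dual_simps)
  note eqI = dual_eqI[where R = R and E = E and M = M]
  show ?thesis
  proof (rule moduleI)
    show "cring R" by (rule E.R.is_cring)
    show "abelian_group (dual R E M)"
    proof (rule abelian_groupI)
      fix f assume f: "f \<in> carrier (dual R E M)"
      show "\<exists>g\<in>carrier (dual R E M). g \<oplus>\<^bsub>dual R E M\<^esub> f = \<zero>\<^bsub>dual R E M\<^esub>"
      proof (rule bexI)
        show "(\<ominus>\<^bsub>R\<^esub> \<one>\<^bsub>R\<^esub>) \<odot>\<^bsub>dual R E M\<^esub> f \<oplus>\<^bsub>dual R E M\<^esub> f = \<zero>\<^bsub>dual R E M\<^esub>"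
          by (rule eqI[OF add[OF smult[OF _ f] f] zero])
            (use cl[OF f] in \<open>simp_all add: dual_simps E.smult_l_minus E.M.l_neg\<close>)
      qed (use smult f in simp)
      show "\<zero>\<^bsub>dual R E M\<^esub> \<oplus>\<^bsub>dual R E M\<^esub> f = f"
        by (rule eqI[OF add[OF zero f] f]) (use cl[OF f] in \<open>simp add: dual_simps\<close>)
      fix g assume g: "g \<in> carrier (dual R E M)"
      show "f \<oplus>\<^bsub>dual R E M\<^esub> g = g \<oplus>\<^bsub>dual R E M\<^esub> f"
        by (rule eqI[OF add[OF f g] add[OF g f]])
          (use cl[OF f] cl[OF g] in \<open>simp add: dual_simps E.M.a_comm\<close>)
      fix h assume h: "h \<in> carrier (dual R E M)"
      show "f \<oplus>\<^bsub>dual R E M\<^esub> g \<oplus>\<^bsub>dual R E M\<^esub> h = f \<oplus>\<^bsub>dual R E M\<^esub> (g \<oplus>\<^bsub>dual R E M\<^esub> h)"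
        by (rule eqI[OF add[OF add[OF f g] h] add[OF f add[OF g h]]])
          (use cl[OF f] cl[OF g] cl[OF h] in \<open>simp add: dual_simps E.M.a_assoc\<close>)
    qed (use add zero in simp_all)
    fix f assume f: "f \<in> carrier (dual R E M)"
    show "\<one>\<^bsub>R\<^esub> \<odot>\<^bsub>dual R E M\<^esub> f = f"
      by (rule eqI[OF smult[OF _ f] f]) (use cl[OF f] in \<open>simp_all add: dual_simps\<close>)
    fix a assume a: "a \<in> carrier R"
    show "a \<odot>\<^bsub>dual R E M\<^esub> f \<in> carrier (dual R E M)" using smult a f by simp
    show "a \<odot>\<^bsub>dual R E M\<^esub> (f \<oplus>\<^bsub>dual R E M\<^esub> g) = a \<odot>\<^bsub>dual R E M\<^esub> f \<oplus>\<^bsub>dual R E M\<^esub> a \<odot>\<^bsub>dual R E M\<^esub> g"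
      if g: "g \<in> carrier (dual R E M)" for g
      by (rule eqI[OF smult[OF a add[OF f g]] add[OF smult[OF a f] smult[OF a g]]])
        (use a cl[OF f] cl[OF g] in \<open>simp add: dual_simps E.smult_r_distr\<close>)
    fix b assume b: "b \<in> carrier R"
    show "(a \<oplus>\<^bsub>R\<^esub> b) \<odot>\<^bsub>dual R E M\<^esub> f = a \<odot>\<^bsub>dual R E M\<^esub> f \<oplus>\<^bsub>dual R E M\<^esub> b \<odot>\<^bsub>dual R E M\<^esub> f"
      by (rule eqI[OF smult[OF _ f] add[OF smult[OF a f] smult[OF b f]]])
        (use a b cl[OF f] in \<open>simp_all add: dual_simps E.smult_l_distr\<close>)
    show "(a \<otimes>\<^bsub>R\<^esub> b) \<odot>\<^bsub>dual R E M\<^esub> f = a \<odot>\<^bsub>dual R E M\<^esub> (b \<odot>\<^bsub>dual R E M\<^esub> f)"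
      by (rule eqI[OF smult[OF _ f] smult[OF a smult[OF b f]]])
        (use a b cl[OF f] in \<open>simp_all add: dual_simps E.smult_assoc1\<close>)
  qed
qed

lemma common_zeros_submodule:
  assumes "module R E" and "module R M" and F: "F \<subseteq> carrier (dual R E M)"
  shows "submodule {x \<in> carrier M. \<forall>g\<in>F. g x = \<zero>\<^bsub>E\<^esub>} R M"
proof -
  interpret E: module R E by fact
  interpret M: module R M by fact
  have hom: "g \<in> mod_homs R M E" if "g \<in> F" for g using that F by (auto simp: dual_carrier)
  show ?thesis
    unfolding M.submodule_iff
  proof (intro conjI ballI)
    show "\<zero>\<^bsub>M\<^esub> \<in> {x \<in> carrier M. \<forall>g\<in>F. g x = \<zero>\<^bsub>E\<^esub>}"
      using mod_homs_zero[OF assms(2,1) hom] by simp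
    fix x assume x: "x \<in> {x \<in> carrier M. \<forall>g\<in>F. g x = \<zero>\<^bsub>E\<^esub>}"
    show "x \<oplus>\<^bsub>M\<^esub> y \<in> {x \<in> carrier M. \<forall>g\<in>F. g x = \<zero>\<^bsub>E\<^esub>}"
      if y: "y \<in> {x \<in> carrier M. \<forall>g\<in>F. g x = \<zero>\<^bsub>E\<^esub>}" for y
    proof -
      have "g (x \<oplus>\<^bsub>M\<^esub> y) = \<zero>\<^bsub>E\<^esub>" if "g \<in> F" for g
      proof -
        have "x \<in> carrier M" "g x = \<zero>\<^bsub>E\<^esub>" "y \<in> carrier M" "g y = \<zero>\<^bsub>E\<^esub>" using x y that by blast+
        then show ?thesis using mod_homs_add[OF hom[OF that], of x y] by simp
      qed
      then show ?thesis using x y by blast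
    qed
    show "r \<odot>\<^bsub>M\<^esub> x \<in> {x \<in> carrier M. \<forall>g\<in>F. g x = \<zero>\<^bsub>E\<^esub>}" if r: "r \<in> carrier R" for r
    proof -
      have "g (r \<odot>\<^bsub>M\<^esub> x) = \<zero>\<^bsub>E\<^esub>" if "g \<in> F" for g
      proof -
        have "x \<in> carrier M" "g x = \<zero>\<^bsub>E\<^esub>" using x that by blast+
        then show ?thesis using mod_homs_smult[OF hom[OF that] r, of x] r by simp
      qed
      then show ?thesis using x r by blast
    qed
  qed auto
qed

lemma evaluation_hom:
  "b \<in> carrier M \<Longrightarrow> Z \<subseteq> carrier (dual R E M) \<Longrightarrow> (\<lambda>h. h b) \<in> mod_homs R ((dual R E M)\<lparr>carrier := Z\<rparr>) E"
  unfolding mod_homs_iff by (auto simp: dual_simps dual_carrier mod_homs_iff subset_iff)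

lemma dual_hom:
  "h \<in> carrier (dual R E M) \<Longrightarrow> h \<in> mod_homs R (M\<lparr>carrier := carrier M\<rparr>) E"
  by (simp add: dual_carrier)

lemma hom_image_submodule:
  assumes "module R M" "module R N" and f: "f \<in> mod_homs R M N" and C: "submodule C R M"
  shows "submodule (f ` C) R N"
proof -
  interpret M: module R M by fact
  interpret N: module R N by fact
  note Cs = C[unfolded M.submodule_iff]
  have Cc: "c \<in> carrier M" if "c \<in> C" for c using Cs that by auto
  show ?thesis
    unfolding N.submodule_iff
  proof (intro conjI ballI)
    show "f ` C \<subseteq> carrier N" using mod_homs_closed[OF f] Cc by auto
    show "\<zero>\<^bsub>N\<^esub> \<in> f ` C"
      using mod_homs_zero[OF M.module_axioms N.module_axioms f] Cs by (metis imageI)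
  next
    fix u v assume "u \<in> f ` C" "v \<in> f ` C"
    then obtain x y where "x \<in> C" "y \<in> C" "u = f x" "v = f y" by auto
    then have "u \<oplus>\<^bsub>N\<^esub> v = f (x \<oplus>\<^bsub>M\<^esub> y)" "x \<oplus>\<^bsub>M\<^esub> y \<in> C"
      using mod_homs_add[OF f Cc Cc] Cs by simp_all
    then show "u \<oplus>\<^bsub>N\<^esub> v \<in> f ` C" by simp
  next
    fix r u assume r: "r \<in> carrier R" and "u \<in> f ` C"
    then obtain x where "x \<in> C" "u = f x" by auto
    then have "r \<odot>\<^bsub>N\<^esub> u = f (r \<odot>\<^bsub>M\<^esub> x)" "r \<odot>\<^bsub>M\<^esub> x \<in> C"
      using mod_homs_smult[OF f r Cc] Cs r by simp_all
    then show "r \<odot>\<^bsub>N\<^esub> u \<in> f ` C" by simp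
  qed
qed

context complete_socle_module
begin

text \<open>
  Evaluations at generators \<open>F\<close> of \<open>M\<close> have no common zero in the dual other than \<open>0\<close>. So every functional
  \<open>\<phi>\<close> on \<open>Z\<close> is a combination of them, and a combination of evaluations is an evaluation.
\<close>

lemma functional_is_evaluation:
  assumes M: "module R M" and fg: "finitely_generated R M"
    and Z: "submodule Z R (dual R E M)" and \<phi>: "\<phi> \<in> mod_homs R ((dual R E M)\<lparr>carrier := Z\<rparr>) E"
  shows "\<exists>b\<in>carrier M. \<forall>h\<in>Z. \<phi> h = h b"
proof -
  interpret M: module R M by fact
  interpret D: module R "dual R E M" by (rule module_dual[OF E.module_axioms M])
  have Zc: "Z \<subseteq> carrier (dual R E M)" using D.submoduleE(1)[OF Z] .
  have hom: "h \<in> mod_homs R M E" if "h \<in> Z" for h using Zc that by (auto simp: dual_carrier)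
  obtain F where F: "finite F" "F \<subseteq> carrier M" "\<And>N. \<lbrakk>submodule N R M; F \<subseteq> N\<rbrakk> \<Longrightarrow> carrier M \<subseteq> N"
    using fg unfolding finitely_generated_def by auto
  have \<phi>0: "\<phi> \<zero>\<^bsub>dual R E M\<^esub> = \<zero>\<^bsub>E\<^esub>"
    using mod_homs_zero[OF submodule.submodule_is_module[OF Z D.module_axioms] E.module_axioms \<phi>]
    by simp
  have "\<exists>e\<in>{\<lambda>h. h b | b. b \<in> carrier M}. \<forall>h\<in>Z. \<phi> h = e h"
  proof (rule in_span_if_kernels[OF D.module_axioms, where S = "carrier E" and G = "(\<lambda>b h. h b) ` F"])
    show "e \<in> mod_homs R ((dual R E M)\<lparr>carrier := Z\<rparr>) E" if "e \<in> {\<lambda>h. h b | b. b \<in> carrier M}" for e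
      using that evaluation_hom[OF _ Zc] by auto
    show "\<exists>e\<in>{\<lambda>h. h b | b. b \<in> carrier M}. \<forall>h\<in>Z. e h = \<zero>\<^bsub>E\<^esub>"
      using mod_homs_zero[OF M E.module_axioms hom] by (intro bexI[of _ "\<lambda>h. h \<zero>\<^bsub>M\<^esub>"]) auto
    show "\<exists>e'\<in>{\<lambda>h. h b | b. b \<in> carrier M}. \<forall>h\<in>Z. e' h = e h \<oplus>\<^bsub>E\<^esub> r \<odot>\<^bsub>E\<^esub> k h"
      if e: "e \<in> {\<lambda>h. h b | b. b \<in> carrier M}" and k: "k \<in> (\<lambda>b h. h b) ` F" and r: "r \<in> carrier R"
      for e k r
    proof -
      obtain b c where "b \<in> carrier M" "e = (\<lambda>h. h b)" "c \<in> carrier M" "k = (\<lambda>h. h c)"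
        using e k F(2) by auto
      then show ?thesis using r mod_homs_add[OF hom] mod_homs_smult[OF hom]
        by (intro bexI[of _ "\<lambda>h. h (b \<oplus>\<^bsub>M\<^esub> r \<odot>\<^bsub>M\<^esub> c)"]) auto
    qed
    show "k \<in> mod_homs R ((dual R E M)\<lparr>carrier := Z\<rparr>) E" if "k \<in> (\<lambda>b h. h b) ` F" for k
      using that evaluation_hom[OF _ Zc] F(2) by auto
    show "k h \<in> carrier E" if "k \<in> (\<lambda>b h. h b) ` F" "h \<in> Z" for k h
      using that F(2) mod_homs_closed[OF hom] by auto
    show "\<phi> h = \<zero>\<^bsub>E\<^esub>" if h: "h \<in> Z" and F0: "\<forall>k\<in>(\<lambda>b h. h b) ` F. k h = \<zero>\<^bsub>E\<^esub>" for h
    proof -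
      have hD: "h \<in> carrier (dual R E M)" using h Zc by auto
      have "submodule {b \<in> carrier M. h b \<in> {\<zero>\<^bsub>E\<^esub>}} R M"
        by (rule kernel_submodule[OF M M.carrier_is_submodule dual_hom[OF hD] E.submodule_zero])
      then have "carrier M \<subseteq> {b \<in> carrier M. h b \<in> {\<zero>\<^bsub>E\<^esub>}}"
        by (rule F(3)) (use F(2) F0 in auto)
      then have "h = \<zero>\<^bsub>dual R E M\<^esub>"
        by (intro dual_eqI[OF hD D.M.zero_closed]) (auto simp: dual_simps)
      then show ?thesis using \<phi>0 by simp
    qed
  qed (use F(1) Z \<phi> factor_through[OF D.module_axioms] in simp_all)
  then show ?thesis by auto
qed

text \<open>
  If \<open>f \<notin> L\<close>, some functional on \<open>L + Rf\<close> vanishes on \<open>L\<close> but not at \<open>f\<close>. It is evaluation at some \<open>b\<close>, which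
  is then a zero of all of \<open>L\<close> but not of \<open>f\<close>.
\<close>

lemma dual_submodule_closed:
  assumes M: "module R M" and fg: "finitely_generated R M"
    and L: "submodule L R (dual R E M)" and f: "f \<in> carrier (dual R E M)"
    and ann: "\<And>b. \<lbrakk>b \<in> carrier M; \<forall>g\<in>L. g b = \<zero>\<^bsub>E\<^esub>\<rbrakk> \<Longrightarrow> f b = \<zero>\<^bsub>E\<^esub>"
  shows "f \<in> L"
proof (rule ccontr)
  assume "f \<notin> L"
  then obtain Z \<phi> where Z: "submodule Z R (dual R E M)" "L \<subseteq> Z" "f \<in> Z"
    and \<phi>: "\<phi> \<in> mod_homs R ((dual R E M)\<lparr>carrier := Z\<rparr>) E" "\<forall>g\<in>L. \<phi> g = \<zero>\<^bsub>E\<^esub>" "\<phi> f = e0"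
    using separating_functional[OF module_dual[OF E.module_axioms M] L f] by auto
  obtain b where b: "b \<in> carrier M" "\<And>h. h \<in> Z \<Longrightarrow> \<phi> h = h b"
    using functional_is_evaluation[OF M fg Z(1) \<phi>(1)] by auto
  have "\<forall>g\<in>L. g b = \<zero>\<^bsub>E\<^esub>" using b(2) \<phi>(2) Z(2) by (metis subsetD)
  then have "f b = \<zero>\<^bsub>E\<^esub>" by (rule ann[OF b(1)])
  then show False using b(2)[OF Z(3)] \<phi>(3) e0(2) by simp
qed

text \<open>
  By the descending chain condition, the common kernel of \<open>L\<close> is that of some finite \<open>F \<subseteq> L\<close>. Any \<open>f\<close> that
  vanishes on it is then a combination of \<open>F\<close>. For \<open>L\<close> a submodule this shows that \<open>L\<close> is an
  annihilator; for \<open>L\<close> the whole dual, that the dual is finitely generated.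
\<close>

lemma artinian_dual_span:
  assumes M: "artinian_module R M" and L: "L \<subseteq> carrier (dual R E M)"
  shows "\<exists>F. finite F \<and> F \<subseteq> L \<and> (\<forall>N f. submodule N R (dual R E M) \<longrightarrow> F \<subseteq> N \<longrightarrow>
    f \<in> carrier (dual R E M) \<longrightarrow> (\<forall>x\<in>carrier M. (\<forall>g\<in>L. g x = \<zero>\<^bsub>E\<^esub>) \<longrightarrow> f x = \<zero>\<^bsub>E\<^esub>) \<longrightarrow> f \<in> N)"
proof -
  interpret M: module R M using M by (simp add: artinian_module_def)
  interpret D: module R "dual R E M" by (rule module_dual[OF E.module_axioms M.module_axioms])
  define K where "K F = {x \<in> carrier M. \<forall>g\<in>F. g x = \<zero>\<^bsub>E\<^esub>}" for F
  have Ksub: "submodule (K F) R M" if "F \<subseteq> L" for F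
    unfolding K_def using common_zeros_submodule[OF E.module_axioms M.module_axioms] that L by simp
  have "\<exists>F. finite F \<and> F \<subseteq> L \<and> K F \<subseteq> K L"
  proof (rule ccontr)
    assume no: "\<not> ?thesis"
    have "\<exists>F. \<forall>n. (finite (F n) \<and> F n \<subseteq> L) \<and> F n \<subseteq> F (Suc n) \<and> K (F (Suc n)) \<noteq> K (F n)"
    proof (rule dependent_nat_choice)
      show "\<exists>F. finite F \<and> F \<subseteq> L" by (rule exI[of _ "{}"]) simp
      fix F and n :: nat assume F: "finite F \<and> F \<subseteq> L"
      then obtain x where x: "x \<in> K F" "x \<notin> K L" using no by auto
      then obtain g where g: "g \<in> L" "g x \<noteq> \<zero>\<^bsub>E\<^esub>" by (auto simp: K_def)
      then have "x \<notin> K (insert g F)" by (simp add: K_def)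
      then show "\<exists>G. (finite G \<and> G \<subseteq> L) \<and> F \<subseteq> G \<and> K G \<noteq> K F"
        using F g(1) x(1) by (intro exI[of _ "insert g F"]) auto
    qed
    then obtain F where F: "\<And>n. F n \<subseteq> L" "\<And>n. F n \<subseteq> F (Suc n)" "\<And>n. K (F (Suc n)) \<noteq> K (F n)"
      by auto
    have "K (F (Suc n)) \<subseteq> K (F n)" for n using F(2) by (auto simp: K_def)
    then have "\<exists>n. \<forall>k\<ge>n. K (F k) = K (F n)"
      using M[unfolded artinian_module_def, THEN conjunct2, rule_format, of "\<lambda>n. K (F n)"]
        Ksub[OF F(1)] by simp
    then show False using F(3) by (metis le_SucI order_refl)
  qed
  then obtain F where F: "finite F" "F \<subseteq> L" "K F \<subseteq> K L" by auto
  have "f \<in> N" if N: "submodule N R (dual R E M)" "F \<subseteq> N" and f: "f \<in> carrier (dual R E M)"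
    and ann: "\<forall>x\<in>carrier M. (\<forall>g\<in>L. g x = \<zero>\<^bsub>E\<^esub>) \<longrightarrow> f x = \<zero>\<^bsub>E\<^esub>" for N f
  proof -
    note Ns = N(1)[unfolded D.submodule_iff]
    have "\<exists>h\<in>N. \<forall>y\<in>carrier M. f y = h y"
    proof (rule in_span_if_kernels[OF M.module_axioms, where S = "carrier E" and G = F])
      show "h \<in> mod_homs R (M\<lparr>carrier := carrier M\<rparr>) E" if "h \<in> N" for h
        using Ns that by (intro dual_hom) auto
      show "\<exists>h\<in>N. \<forall>y\<in>carrier M. h y = \<zero>\<^bsub>E\<^esub>"
        using Ns by (intro bexI[of _ "\<zero>\<^bsub>dual R E M\<^esub>"]) (simp_all add: dual_simps)
      show "\<exists>h'\<in>N. \<forall>y\<in>carrier M. h' y = h y \<oplus>\<^bsub>E\<^esub> r \<odot>\<^bsub>E\<^esub> g y"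
        if "h \<in> N" "g \<in> F" "r \<in> carrier R" for h g r
      proof (rule bexI)
        show "\<forall>y\<in>carrier M. (h \<oplus>\<^bsub>dual R E M\<^esub> r \<odot>\<^bsub>dual R E M\<^esub> g) y = h y \<oplus>\<^bsub>E\<^esub> r \<odot>\<^bsub>E\<^esub> g y"
          by (simp add: dual_simps)
        have "g \<in> N" using N(2) that(2) by auto
        then show "h \<oplus>\<^bsub>dual R E M\<^esub> r \<odot>\<^bsub>dual R E M\<^esub> g \<in> N" using Ns that by simp
      qed
      show "g \<in> mod_homs R (M\<lparr>carrier := carrier M\<rparr>) E" if "g \<in> F" for g
        using that F(2) L by (intro dual_hom) auto
      show "g y \<in> carrier E" if "g \<in> F" "y \<in> carrier M" for g y
        using that F(2) L by (auto simp: dual_carrier mod_homs_iff subset_iff)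
      show "f y = \<zero>\<^bsub>E\<^esub>" if "y \<in> carrier M" "\<forall>g\<in>F. g y = \<zero>\<^bsub>E\<^esub>" for y
      proof -
        have "y \<in> K L" using that F(3) by (auto simp: K_def)
        then show ?thesis using ann by (simp add: K_def)
      qed
      show "f \<in> mod_homs R (M\<lparr>carrier := carrier M\<rparr>) E" by (rule dual_hom[OF f])
    qed (use F(1) M.carrier_is_submodule factor_through[OF M.module_axioms] in simp_all)
    then obtain h where h: "h \<in> N" "\<And>y. y \<in> carrier M \<Longrightarrow> f y = h y" by auto
    have "f = h" by (rule dual_eqI[OF f]) (use h Ns in auto)
    then show ?thesis using h(1) by simp
  qed
  then show ?thesis using F(1,2) by (intro exI[of _ F]) auto
qed

lemma eval_hom:
  assumes "module R M"
  shows "eval_map R E M \<in> mod_homs R M (dual R E (dual R E M))"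
proof -
  interpret M: module R M by fact
  interpret D: module R "dual R E M" by (rule module_dual[OF E.module_axioms assms])
  have hom: "f \<in> mod_homs R M E" if "f \<in> carrier (dual R E M)" for f
    using that by (simp add: dual_carrier)
  have "eval_map R E M x \<in> carrier (dual R E (dual R E M))" if "x \<in> carrier M" for x
    unfolding eval_map_def
    using evaluation_hom[OF that subset_refl, of R E] by (intro dual_restrict D.module_axioms) simp
  then show ?thesis
    unfolding mod_homs_iff[of "eval_map R E M"]
    using mod_homs_add[OF hom] mod_homs_smult[OF hom]
    by (auto simp: eval_map_def dual_simps fun_eq_iff)
qed

lemma matlis_dual_submodules:
  assumes M: "noetherian_module R M \<or> artinian_module R M"
    and L: "submodule L R (dual R E M)" and f: "f \<in> carrier (dual R E M)"
    and ann: "\<And>b. \<lbrakk>b \<in> carrier M; \<forall>g\<in>L. g b = \<zero>\<^bsub>E\<^esub>\<rbrakk> \<Longrightarrow> f b = \<zero>\<^bsub>E\<^esub>"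
  shows "f \<in> L"
  using M
proof
  assume n: "noetherian_module R M"
  then have "module R M" by (simp add: noetherian_module_def)
  then show ?thesis
    by (rule dual_submodule_closed[OF _ noetherian_finitely_generated[OF n] L f ann])
next
  assume a: "artinian_module R M"
  then have "module R M" by (simp add: artinian_module_def)
  then have "L \<subseteq> carrier (dual R E M)"
    using module.submoduleE(1)[OF module_dual[OF E.module_axioms] L] by simp
  from artinian_dual_span[OF a this] L f ann show ?thesis by metis
qed

text \<open>
  In the Artinian case the dual is finitely generated, so the image of evaluation, being a submodule of
  the double dual, is an annihilator. As only the zero functional on \<open>M\<close> vanishes under all evaluations, it is everything.
\<close>

lemma matlis_reflexive:
  assumes M: "noetherian_module R M \<or> artinian_module R M"
    and \<Phi>: "\<Phi> \<in> carrier (dual R E (dual R E M))"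
  shows "\<Phi> \<in> eval_map R E M ` carrier M"
  using M
proof
  assume n: "noetherian_module R M"
  then have Mm: "module R M" by (simp add: noetherian_module_def)
  interpret D: module R "dual R E M" by (rule module_dual[OF E.module_axioms Mm])
  obtain b where b: "b \<in> carrier M" "\<And>h. h \<in> carrier (dual R E M) \<Longrightarrow> \<Phi> h = h b"
    using functional_is_evaluation[OF Mm noetherian_finitely_generated[OF n] D.carrier_is_submodule
        dual_hom[OF \<Phi>]] by auto
  have "\<Phi> = eval_map R E M b"
    by (rule dual_eqI[OF \<Phi> mod_homs_closed[OF eval_hom[OF Mm] b(1)]]) (simp add: eval_map_def b(2))
  then show ?thesis using b(1) by simp
next
  assume a: "artinian_module R M"
  then have Mm: "module R M" by (simp add: artinian_module_def)
  interpret M: module R M by fact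
  interpret D: module R "dual R E M" by (rule module_dual[OF E.module_axioms Mm])
  interpret DD: module R "dual R E (dual R E M)" by (rule module_dual[OF E.module_axioms D.module_axioms])
  have fg: "finitely_generated R (dual R E M)"
    unfolding finitely_generated_def
    using artinian_dual_span[OF a subset_refl] by (metis subsetI)
  note hom = eval_hom[OF Mm]
  show ?thesis
  proof (rule dual_submodule_closed[OF D.module_axioms fg _ \<Phi>])
    show "submodule (eval_map R E M ` carrier M) R (dual R E (dual R E M))"
      by (rule hom_image_submodule[OF Mm DD.module_axioms hom M.carrier_is_submodule])
    fix h assume h: "h \<in> carrier (dual R E M)" "\<forall>\<Psi>\<in>eval_map R E M ` carrier M. \<Psi> h = \<zero>\<^bsub>E\<^esub>"
    have "h = \<zero>\<^bsub>dual R E M\<^esub>"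
      by (rule dual_eqI[OF h(1) D.M.zero_closed]) (use h in \<open>auto simp: eval_map_def dual_simps\<close>)
    then show "\<Phi> h = \<zero>\<^bsub>E\<^esub>"
      using mod_homs_zero[OF D.module_axioms E.module_axioms, of \<Phi>] \<Phi> by (simp add: dual_carrier)
  qed
qed

end

section \<open>Duals of quotients as annihilators\<close>

locale module_quotient = module R M for R and M :: "('r, 'm) module" (structure) +
  fixes C
  assumes C: "submodule C R M"
begin

sublocale coset: abelian_subgroup C M
  using C by (intro abelian_subgroupI3 additive_subgroup.intro submodule.axioms(1))
    (simp_all add: M.abelian_group_axioms)

lemma C_carrier: "c \<in> C \<Longrightarrow> c \<in> carrier M"
  using submoduleE(1)[OF C] by auto

lemma coset_eq: "\<lbrakk>x \<in> carrier M; c \<in> C\<rbrakk> \<Longrightarrow> C +> (c \<oplus> x) = C +> x"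
  by (rule a_repr_independence[OF _ _ submodule.axioms(1)[OF C], symmetric])
    (auto simp: a_r_coset_def')

lemma coset_self_eq: "c \<in> C \<Longrightarrow> C +> c = C +> \<zero>"
  using coset_eq[of \<zero> c] C_carrier[of c] by simp

lemma in_coset: "z \<in> C +> x \<longleftrightarrow> (\<exists>c\<in>C. z = c \<oplus> x)"
  by (auto simp: a_r_coset_def')

lemma quot_carrier: "S \<in> carrier (quot_module M C) \<longleftrightarrow> (\<exists>x\<in>carrier M. S = C +> x)"
  by (auto simp: quot_module_def A_RCOSETS_def')

lemma quot_add:
  "\<lbrakk>x \<in> carrier M; y \<in> carrier M\<rbrakk>
    \<Longrightarrow> (C +> x) \<oplus>\<^bsub>quot_module M C\<^esub> (C +> y) = C +> (x \<oplus> y)"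
  by (simp add: quot_module_def coset.a_rcos_sum)

lemma quot_smult:
  assumes "r \<in> carrier R" "x \<in> carrier M"
  shows "r \<odot>\<^bsub>quot_module M C\<^esub> (C +> x) = C +> (r \<odot> x)"
proof -
  have "C +> (r \<odot> z) = C +> (r \<odot> x)" if z: "z \<in> C +> x" for z
  proof -
    obtain c where c: "c \<in> C" "z = c \<oplus> x" using z by (auto simp: in_coset)
    then have "r \<odot> z = r \<odot> c \<oplus> r \<odot> x" using assms C_carrier by (simp add: smult_r_distr)
    then show ?thesis using coset_eq[of "r \<odot> x" "r \<odot> c"] assms submoduleE(4)[OF C] c(1) by simp
  qed
  moreover have "C +> x \<noteq> {}" using coset.a_rcos_self[OF assms(2)] by (metis empty_iff)
  ultimately have "(\<Union>z\<in>C +> x. C +> (r \<odot> z)) = C +> (r \<odot> x)" by (intro SUP_eq_const)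
  then show ?thesis by (simp add: quot_module_def)
qed

end

lemma dual_quot_eq:
  assumes "module R E" and "module R M" and "submodule C R M"
  shows "dual_quot R E M C = {f \<in> carrier (dual R E M). \<forall>c\<in>C. f c = \<zero>\<^bsub>E\<^esub>}"
proof (intro equalityI subsetI)
  interpret E: module R E by fact
  interpret Q: module_quotient R M C
    using assms by (simp add: module_quotient_def module_quotient_axioms_def)
  let ?Q = "quot_module M C"
  fix f assume "f \<in> dual_quot R E M C"
  then obtain g where g: "g \<in> mod_homs R ?Q E" and f: "f = (\<lambda>x\<in>carrier M. g (C +>\<^bsub>M\<^esub> x))"
    by (auto simp: dual_quot_def dual_carrier)
  have cos: "C +>\<^bsub>M\<^esub> x \<in> carrier ?Q" if "x \<in> carrier M" for x using that by (auto simp: Q.quot_carrier)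
  have hom: "f \<in> mod_homs R M E"
    unfolding mod_homs_iff[of f]
    using mod_homs_closed[OF g cos] mod_homs_add[OF g cos cos] mod_homs_smult[OF g _ cos]
    by (simp add: f Q.quot_add Q.quot_smult)
  have "f c = \<zero>\<^bsub>E\<^esub>" if "c \<in> C" for c
  proof -
    have "f c = f \<zero>\<^bsub>M\<^esub>" using Q.C_carrier[OF that] Q.coset_self_eq[OF that] by (simp add: f)
    then show ?thesis using mod_homs_zero[OF assms(2,1) hom] by simp
  qed
  then show "f \<in> {f \<in> carrier (dual R E M). \<forall>c\<in>C. f c = \<zero>\<^bsub>E\<^esub>}"
    using hom by (simp add: dual_carrier f)
next
  interpret E: module R E by fact
  interpret Q: module_quotient R M C
    using assms by (simp add: module_quotient_def module_quotient_axioms_def)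
  let ?Q = "quot_module M C"
  fix f assume "f \<in> {f \<in> carrier (dual R E M). \<forall>c\<in>C. f c = \<zero>\<^bsub>E\<^esub>}"
  then have f: "f \<in> carrier (dual R E M)" "f \<in> mod_homs R M E" "\<And>c. c \<in> C \<Longrightarrow> f c = \<zero>\<^bsub>E\<^esub>"
    by (simp_all add: dual_carrier)
  define g where "g = (\<lambda>S\<in>carrier ?Q. f (SOME z. z \<in> S))"
  have g: "g (C +>\<^bsub>M\<^esub> x) = f x" if x: "x \<in> carrier M" for x
  proof -
    have "(SOME z. z \<in> C +>\<^bsub>M\<^esub> x) \<in> C +>\<^bsub>M\<^esub> x"
      by (rule someI[of _ x]) (rule Q.coset.a_rcos_self[OF x])
    then obtain c where c: "c \<in> C" "(SOME z. z \<in> C +>\<^bsub>M\<^esub> x) = c \<oplus>\<^bsub>M\<^esub> x" unfolding Q.in_coset by auto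
    have "f (c \<oplus>\<^bsub>M\<^esub> x) = f x"
      using mod_homs_add[OF f(2) Q.C_carrier[OF c(1)] x] f(3)[OF c(1)] mod_homs_closed[OF f(2) x]
      by simp
    moreover have "C +>\<^bsub>M\<^esub> x \<in> carrier ?Q" using x by (auto simp: Q.quot_carrier)
    ultimately show ?thesis using c(2) by (simp add: g_def)
  qed
  have "g \<in> carrier (dual R E ?Q)"
    unfolding dual_carrier mod_homs_iff[of g]
    using mod_homs_closed[OF f(2)] mod_homs_add[OF f(2)] mod_homs_smult[OF f(2)]
    by (auto simp: Q.quot_carrier Q.quot_add Q.quot_smult g) (simp add: g_def)
  moreover have "f = (\<lambda>x\<in>carrier M. g (C +>\<^bsub>M\<^esub> x))"
    using f(1) g by (auto simp: dual_carrier extensional_def restrict_def fun_eq_iff)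
  ultimately show "f \<in> dual_quot R E M C" unfolding dual_quot_def by auto
qed

section \<open>The injective hull of the residue field\<close>

lemma local_ring_unit:
  assumes "local_cring R \<mm>" "noetherian_ring R" "a \<in> carrier R" "a \<notin> \<mm>"
  shows "a \<in> Units R"
proof (rule ccontr)
  interpret cring R using assms(1) by (simp add: local_cring_def)
  assume nu: "a \<notin> Units R"
  define \<A> where "\<A> = {J. ideal J R \<and> a \<in> J \<and> \<one>\<^bsub>R\<^esub> \<notin> J}"
  have "\<one>\<^bsub>R\<^esub> \<notin> PIdl\<^bsub>R\<^esub> a"
  proof
    assume "\<one>\<^bsub>R\<^esub> \<in> PIdl\<^bsub>R\<^esub> a"
    then obtain b where "b \<in> carrier R" "b \<otimes>\<^bsub>R\<^esub> a = \<one>\<^bsub>R\<^esub>" by (auto simp: cgenideal_def)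
    then show False using nu assms(3) m_comm[of a b] by (auto simp: Units_def)
  qed
  then have "PIdl\<^bsub>R\<^esub> a \<in> \<A>"
    using cgenideal_ideal[OF assms(3)] cgenideal_self[OF assms(3)] by (simp add: \<A>_def)
  then have "\<exists>M\<in>\<A>. \<forall>I\<in>\<A>. M \<subseteq> I \<longrightarrow> I = M"
    by (intro noetherian_ring.ideals_have_maximal[OF assms(2)]) (auto simp: \<A>_def)
  then obtain M where M: "M \<in> \<A>" "\<And>I. \<lbrakk>I \<in> \<A>; M \<subseteq> I\<rbrakk> \<Longrightarrow> I = M" by auto
  then have Mi: "ideal M R" "a \<in> M" "\<one>\<^bsub>R\<^esub> \<notin> M" by (simp_all add: \<A>_def)
  have "maximalideal M R"
  proof (rule maximalidealI[OF Mi(1)])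
    show "carrier R \<noteq> M" using Mi(3) by auto
    fix J assume J: "ideal J R" "M \<subseteq> J" "J \<subseteq> carrier R"
    show "J = M \<or> J = carrier R"
    proof (cases "\<one>\<^bsub>R\<^esub> \<in> J")
      case True
      then show ?thesis using ideal.one_imp_carrier[OF J(1)] by simp
    next
      case False
      then have "J \<in> \<A>" using J Mi(2) by (auto simp: \<A>_def)
      then show ?thesis using M(2)[OF _ J(2)] by simp
    qed
  qed
  then have "M = \<mm>" using assms(1) by (simp add: local_cring_def)
  then show False using Mi(2) assms(4) by simp
qed

lemma module_ring_as_module: "cring R \<Longrightarrow> module R (ring_as_module R)"
proof -
  assume "cring R"
  then interpret cring R .
  have "abelian_group (ring_as_module R)"
  proof (rule abelian_groupI)
    fix x assume "x \<in> carrier (ring_as_module R)"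
    then show "\<exists>y\<in>carrier (ring_as_module R).
        y \<oplus>\<^bsub>ring_as_module R\<^esub> x = \<zero>\<^bsub>ring_as_module R\<^esub>"
      by (intro bexI[of _ "\<ominus>\<^bsub>R\<^esub> x"]) (simp_all add: ring_as_module_def l_neg)
  qed (simp_all add: ring_as_module_def a_ac)
  then show ?thesis
    by (intro moduleI cring_axioms) (simp_all add: ring_as_module_def l_distr r_distr m_assoc)
qed

text \<open>
  The image of \<open>1 + \<mm>\<close> in the hull serves as \<open>e0\<close>. A nonzero submodule \<open>Rx\<close> meets the image of \<open>k\<close> in some
  nonzero \<open>s e0\<close>; then \<open>s\<close> is a unit, so \<open>e0 \<in> Rx\<close>.
\<close>

lemma injective_hull_socle:
  fixes R :: "('r, 'x) ring_scheme"
  assumes loc: "local_cring R \<mm>" and noeth: "noetherian_ring R" and compl: "adically_complete R \<mm>"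
    and hull: "injective_hull R U (quot_module (ring_as_module R) \<mm>) E"
  shows "\<exists>e0. complete_socle_module R \<mm> E e0"
proof -
  have cr: "cring R" and max: "maximalideal \<mm> R" using loc by (simp_all add: local_cring_def)
  have id: "ideal \<mm> R" using max by (rule maximalideal.axioms(1))
  interpret cring R by (rule cr)
  let ?M = "ring_as_module R"
  let ?K = "quot_module ?M \<mm>"
  have M: "module R ?M" by (rule module_ring_as_module[OF cr])
  have Ms: "carrier ?M = carrier R" "\<zero>\<^bsub>?M\<^esub> = \<zero>\<^bsub>R\<^esub>" "(\<oplus>\<^bsub>?M\<^esub>) = (\<oplus>\<^bsub>R\<^esub>)" "(\<odot>\<^bsub>?M\<^esub>) = (\<otimes>\<^bsub>R\<^esub>)"
    by (simp_all add: ring_as_module_def)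
  interpret nl: noetherian_local R \<mm>
    by (intro noetherian_local.intro noetherian_local_axioms.intro cr noeth id
        local_ring_unit[OF loc noeth])
  have "submodule \<mm> R ?M"
    unfolding module.submodule_iff[OF M] Ms
    using nl.m_carrier ideal_plus[OF id] ideal.I_l_closed[OF id]
      additive_subgroup.zero_closed[OF ideal.axioms(1)[OF id]] by auto
  then interpret Q: module_quotient R ?M \<mm>
    using M by (simp add: module_quotient_def module_quotient_axioms_def)
  from hull obtain j where E: "module R E" and j: "j \<in> mod_homs R ?K E"
    and inj: "inj_on j (carrier ?K)" and ess: "essential_submodule R (j ` carrier ?K) E"
    by (auto simp: injective_hull_def injective_module_def)
  interpret E: module R E by (rule E)
  have cos: "\<mm> +>\<^bsub>?M\<^esub> r \<in> carrier ?K" if "r \<in> carrier R" for r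
    using that by (auto simp: Q.quot_carrier Ms)
  define e0 where "e0 = j (\<mm> +>\<^bsub>?M\<^esub> \<one>\<^bsub>R\<^esub>)"
  have e0: "e0 \<in> carrier E" unfolding e0_def by (rule mod_homs_closed[OF j cos]) simp
  have mult: "j (\<mm> +>\<^bsub>?M\<^esub> r) = r \<odot>\<^bsub>E\<^esub> e0" if "r \<in> carrier R" for r
    using mod_homs_smult[OF j that cos[OF one_closed]] Q.quot_smult[of r "\<one>\<^bsub>R\<^esub>"] that
    by (simp add: e0_def Ms)
  have m_e0: "a \<odot>\<^bsub>E\<^esub> e0 = \<zero>\<^bsub>E\<^esub>" if "a \<in> \<mm>" for a
    using mult[OF nl.m_carrier[OF that]] mult[OF zero_closed] Q.coset_self_eq[OF that] e0
    by (simp add: Ms)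
  have one: "\<one>\<^bsub>R\<^esub> \<notin> \<mm>" using maximalideal.I_notcarr[OF max] ideal.one_imp_carrier[OF id] by auto
  have "e0 \<noteq> \<zero>\<^bsub>E\<^esub>"
  proof
    assume "e0 = \<zero>\<^bsub>E\<^esub>"
    then have "j (\<mm> +>\<^bsub>?M\<^esub> \<one>\<^bsub>R\<^esub>) = j (\<mm> +>\<^bsub>?M\<^esub> \<zero>\<^bsub>R\<^esub>)" using mult[of "\<zero>\<^bsub>R\<^esub>"] mult[of "\<one>\<^bsub>R\<^esub>"] by simp
    then have "\<mm> +>\<^bsub>?M\<^esub> \<one>\<^bsub>R\<^esub> = \<mm> +>\<^bsub>?M\<^esub> \<zero>\<^bsub>R\<^esub>" using inj_onD[OF inj] cos by simp
    then have "\<one>\<^bsub>R\<^esub> \<in> \<mm> +>\<^bsub>?M\<^esub> \<zero>\<^bsub>R\<^esub>" using Q.coset.a_rcos_self[of "\<one>\<^bsub>R\<^esub>"] by (simp add: Ms)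
    then show False using one nl.m_carrier by (auto simp: Q.in_coset Ms)
  qed
  moreover have "\<exists>a\<in>carrier R. a \<odot>\<^bsub>E\<^esub> x = e0" if x: "x \<in> carrier E" "x \<noteq> \<zero>\<^bsub>E\<^esub>" for x
  proof -
    define N where "N = {r \<odot>\<^bsub>E\<^esub> x | r. r \<in> carrier R}"
    have NI: "r \<odot>\<^bsub>E\<^esub> x \<in> N" if "r \<in> carrier R" for r using that by (auto simp: N_def)
    have N: "submodule N R E"
      unfolding E.submodule_iff
    proof (intro conjI ballI)
      show "N \<subseteq> carrier E" using x by (auto simp: N_def)
      show "\<zero>\<^bsub>E\<^esub> \<in> N" using NI[of "\<zero>\<^bsub>R\<^esub>"] x by simp
      show "u \<oplus>\<^bsub>E\<^esub> v \<in> N" if uv: "u \<in> N" "v \<in> N" for u v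
      proof -
        obtain r s where "r \<in> carrier R" "u = r \<odot>\<^bsub>E\<^esub> x" "s \<in> carrier R" "v = s \<odot>\<^bsub>E\<^esub> x"
          using uv by (auto simp: N_def)
        then show ?thesis using NI[of "r \<oplus>\<^bsub>R\<^esub> s"] x by (simp add: E.smult_l_distr)
      qed
      show "r \<odot>\<^bsub>E\<^esub> u \<in> N" if r: "r \<in> carrier R" and u: "u \<in> N" for r u
      proof -
        obtain s where "s \<in> carrier R" "u = s \<odot>\<^bsub>E\<^esub> x" using u by (auto simp: N_def)
        then show ?thesis using NI[of "r \<otimes>\<^bsub>R\<^esub> s"] x r by (simp add: E.smult_assoc1)
      qed
    qed
    have "x \<in> N" using NI[of "\<one>\<^bsub>R\<^esub>"] x by simp
    then have "N \<noteq> {\<zero>\<^bsub>E\<^esub>}" using x(2) by auto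
    then have "N \<inter> j ` carrier ?K \<noteq> {\<zero>\<^bsub>E\<^esub>}" using ess N by (simp add: essential_submodule_def)
    moreover have "\<zero>\<^bsub>E\<^esub> \<in> N \<inter> j ` carrier ?K"
      using N ess by (simp add: essential_submodule_def E.submodule_iff)
    ultimately obtain y where y: "y \<in> N" "y \<in> j ` carrier ?K" "y \<noteq> \<zero>\<^bsub>E\<^esub>" by auto
    obtain r s where r: "r \<in> carrier R" "y = r \<odot>\<^bsub>E\<^esub> x" and s: "s \<in> carrier R" "y = s \<odot>\<^bsub>E\<^esub> e0"
      using y(1,2) mult by (auto simp: N_def Q.quot_carrier Ms)
    have "s \<notin> \<mm>" using y(3) s m_e0 by auto
    then have u: "s \<in> Units R" using nl.unit s(1) by simp
    have "(inv\<^bsub>R\<^esub> s \<otimes>\<^bsub>R\<^esub> r) \<odot>\<^bsub>E\<^esub> x = inv\<^bsub>R\<^esub> s \<odot>\<^bsub>E\<^esub> (s \<odot>\<^bsub>E\<^esub> e0)"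
      using u r s x by (simp add: E.smult_assoc1)
    also have "\<dots> = (inv\<^bsub>R\<^esub> s \<otimes>\<^bsub>R\<^esub> s) \<odot>\<^bsub>E\<^esub> e0"
      using u s e0 by (simp add: E.smult_assoc1 del: Units_l_inv)
    also have "\<dots> = e0" using u e0 by simp
    finally show ?thesis using u r(1) by (intro bexI[of _ "inv\<^bsub>R\<^esub> s \<otimes>\<^bsub>R\<^esub> r"]) simp_all
  qed
  ultimately have "complete_socle_module R \<mm> E e0"
    by (intro complete_socle_module.intro complete_socle_module_axioms.intro socle_module.intro
        socle_module_axioms.intro nl.noetherian_local_axioms E e0 m_e0 compl)
  then show ?thesis by (rule exI)
qed

section \<open>Matlis duality for submodules\<close>

locale matlis_module = complete_socle_module R \<mm> E e0
  for R :: "('a, 'x) ring_scheme" (structure) and \<mm> and E :: "('a, 'e) module" and e0 +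
  fixes B :: "('a, 'u) module"
  assumes injective: "injective_module R TYPE('u) E"
    and chain_condition: "noetherian_module R B \<or> artinian_module R B"
begin

sublocale B: module R B
  using chain_condition by (auto simp: noetherian_module_def artinian_module_def)

sublocale D: module R "dual R E B"
  by (rule module_dual[OF E.module_axioms B.module_axioms])

sublocale DD: module R "dual R E (dual R E B)"
  by (rule module_dual[OF E.module_axioms D.module_axioms])

definition zeros :: "('u \<Rightarrow> 'e) set \<Rightarrow> 'u set" where
  "zeros L = {b \<in> carrier B. \<forall>g\<in>L. g b = \<zero>\<^bsub>E\<^esub>}"

abbreviation perp :: "'u set \<Rightarrow> ('u \<Rightarrow> 'e) set" where
  "perp C \<equiv> dual_quot R E B C"

lemma perp_eq: "submodule C R B \<Longrightarrow> perp C = {f \<in> carrier (dual R E B). \<forall>c\<in>C. f c = \<zero>\<^bsub>E\<^esub>}"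
  by (rule dual_quot_eq[OF E.module_axioms B.module_axioms])

lemma dual_mod_hom: "f \<in> carrier (dual R E B) \<Longrightarrow> f \<in> mod_homs R B E"
  by (simp add: dual_carrier)

lemma perp_submodule:
  assumes C: "submodule C R B"
  shows "submodule (perp C) R (dual R E B)"
proof -
  have CB: "c \<in> carrier B" if "c \<in> C" for c using B.submoduleE(1)[OF C] that by auto
  show ?thesis
    unfolding D.submodule_iff perp_eq[OF C]
  proof (intro conjI ballI)
    show "\<zero>\<^bsub>dual R E B\<^esub> \<in> {f \<in> carrier (dual R E B). \<forall>c\<in>C. f c = \<zero>\<^bsub>E\<^esub>}"
      using D.M.zero_closed CB unfolding dual_simps(1) by simp
    fix f assume f: "f \<in> {f \<in> carrier (dual R E B). \<forall>c\<in>C. f c = \<zero>\<^bsub>E\<^esub>}"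
    show "f \<oplus>\<^bsub>dual R E B\<^esub> g \<in> {f \<in> carrier (dual R E B). \<forall>c\<in>C. f c = \<zero>\<^bsub>E\<^esub>}"
      if "g \<in> {f \<in> carrier (dual R E B). \<forall>c\<in>C. f c = \<zero>\<^bsub>E\<^esub>}" for g
      using D.M.a_closed[of f g] f that CB unfolding dual_simps(2) by simp
    show "r \<odot>\<^bsub>dual R E B\<^esub> f \<in> {f \<in> carrier (dual R E B). \<forall>c\<in>C. f c = \<zero>\<^bsub>E\<^esub>}"
      if "r \<in> carrier R" for r
      using D.smult_closed[of r f] f that CB unfolding dual_simps(3) by simp
  qed auto
qed

lemma zeros_submodule: "L \<subseteq> carrier (dual R E B) \<Longrightarrow> submodule (zeros L) R B"
  unfolding zeros_def by (rule common_zeros_submodule[OF E.module_axioms B.module_axioms])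

lemma perp_zeros:
  assumes L: "submodule L R (dual R E B)"
  shows "perp (zeros L) = L"
proof -
  have Lc: "L \<subseteq> carrier (dual R E B)" by (rule D.submoduleE(1)[OF L])
  show ?thesis
    unfolding perp_eq[OF zeros_submodule[OF Lc]]
    using matlis_dual_submodules[OF chain_condition L] Lc by (auto simp: zeros_def)
qed

text \<open>
  Injectivity of \<open>E\<close> extends a functional that separates \<open>x\<close> from \<open>C\<close> from \<open>C + Rx\<close> to all of \<open>B\<close>.
\<close>

lemma zeros_perp:
  assumes C: "submodule C R B"
  shows "zeros (perp C) = C"
proof
  show "C \<subseteq> zeros (perp C)" using B.submoduleE(1)[OF C] by (auto simp: zeros_def perp_eq[OF C])
  show "zeros (perp C) \<subseteq> C"
  proof
    fix x assume x: "x \<in> zeros (perp C)"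
    show "x \<in> C"
    proof (rule ccontr)
      assume xC: "x \<notin> C"
      have xB: "x \<in> carrier B" using x by (simp add: zeros_def)
      obtain Z \<phi> where Z: "submodule Z R B" "C \<subseteq> Z" "x \<in> Z"
        and \<phi>: "\<phi> \<in> mod_homs R (B\<lparr>carrier := Z\<rparr>) E" "\<forall>c\<in>C. \<phi> c = \<zero>\<^bsub>E\<^esub>" "\<phi> x = e0"
        using separating_functional[OF B.module_axioms C xB xC] by auto
      obtain f where f: "f \<in> mod_homs R B E" "\<And>z. z \<in> Z \<Longrightarrow> f z = \<phi> z"
        using injective B.module_axioms Z(1) \<phi>(1) unfolding injective_module_def by metis
      have "restrict f (carrier B) \<in> perp C"
        unfolding perp_eq[OF C] using dual_restrict[OF B.module_axioms f(1)] f(2) \<phi>(2) Z(2)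
          B.submoduleE(1)[OF C] by (auto simp: subset_iff)
      then have "f x = \<zero>\<^bsub>E\<^esub>" using x xB by (auto simp: zeros_def)
      then show False using f(2)[OF Z(3)] \<phi>(3) e0(2) by simp
    qed
  qed
qed

lemma eval_iso: "eval_map R E B \<in> mod_isos R B (dual R E (dual R E B))"
proof -
  note hom = eval_hom[OF B.module_axioms]
  have "inj_on (eval_map R E B) (carrier B)"
  proof (rule inj_onI)
    fix x y assume xy: "x \<in> carrier B" "y \<in> carrier B" "eval_map R E B x = eval_map R E B y"
    have "x \<oplus>\<^bsub>B\<^esub> (\<ominus> \<one>) \<odot>\<^bsub>B\<^esub> y \<in> zeros (perp {\<zero>\<^bsub>B\<^esub>})"
    proof -
      have "f (x \<oplus>\<^bsub>B\<^esub> (\<ominus> \<one>) \<odot>\<^bsub>B\<^esub> y) = \<zero>\<^bsub>E\<^esub>" if f: "f \<in> carrier (dual R E B)" for f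
      proof -
        have "f x = f y" using fun_cong[OF xy(3), of f] f by (simp add: eval_map_def)
        then show ?thesis
          using mod_homs_closed[OF dual_mod_hom[OF f] xy(2)] xy(1,2)
          by (simp add: mod_homs_add[OF dual_mod_hom[OF f]] mod_homs_smult[OF dual_mod_hom[OF f]]
              E.smult_l_minus E.M.r_neg del: B.smult_one)
      qed
      then show ?thesis using xy(1,2) by (simp add: zeros_def perp_eq[OF B.submodule_zero])
    qed
    then have "x \<oplus>\<^bsub>B\<^esub> (\<ominus> \<one>) \<odot>\<^bsub>B\<^esub> y = \<zero>\<^bsub>B\<^esub>" by (simp add: zeros_perp[OF B.submodule_zero])
    then show "x = y" using B.eq_smult_if_diff_zero[OF xy(1,2), of \<one>] xy(2) by simp
  qed
  moreover have "eval_map R E B ` carrier B = carrier (dual R E (dual R E B))"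
    using mod_homs_closed[OF hom] matlis_reflexive[OF chain_condition] by auto
  ultimately show ?thesis using hom by (simp add: mod_isos_def bij_betw_def)
qed

lemma dual_quot_dual:
  assumes L: "submodule L R (dual R E B)"
  shows "dual_quot R E (dual R E B) L = eval_map R E B ` zeros L"
proof -
  have Lc: "L \<subseteq> carrier (dual R E B)" by (rule D.submoduleE(1)[OF L])
  have surj: "carrier (dual R E (dual R E B)) = eval_map R E B ` carrier B"
    using eval_iso by (simp add: mod_isos_def bij_betw_def)
  show ?thesis
    unfolding dual_quot_eq[OF E.module_axioms D.module_axioms L] surj
    using Lc by (auto simp: zeros_def eval_map_def subset_iff)
qed

end

section \<open>Interiors and dual closures\<close>

lemma mod_isos_comp:
  "\<lbrakk>\<phi> \<in> mod_isos R M N; \<psi> \<in> mod_isos R N P\<rbrakk> \<Longrightarrow> \<psi> \<circ> \<phi> \<in> mod_isos R M P"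
  by (auto simp: mod_isos_def mod_homs_iff intro: bij_betw_trans)

lemma mod_isos_inv:
  assumes "module R M" "\<phi> \<in> mod_isos R M N"
  shows "inv_into (carrier M) \<phi> \<in> mod_isos R N M"
proof -
  interpret M: module R M by fact
  have hom: "\<phi> \<in> mod_homs R M N" and bij: "bij_betw \<phi> (carrier M) (carrier N)"
    using assms(2) by (simp_all add: mod_isos_def)
  let ?\<psi> = "inv_into (carrier M) \<phi>"
  have inv: "?\<psi> y \<in> carrier M" "\<phi> (?\<psi> y) = y" if "y \<in> carrier N" for y
    using that bij by (simp_all add: bij_betw_def inv_into_into f_inv_into_f)
  have eq: "?\<psi> y = x" if "x \<in> carrier M" "\<phi> x = y" for x y
    using that bij by (auto simp: bij_betw_def inv_into_f_f)
  have "?\<psi> \<in> mod_homs R N M"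
    unfolding mod_homs_iff[of ?\<psi>]
    by (auto intro!: eq simp: inv mod_homs_add[OF hom] mod_homs_smult[OF hom])
  then show ?thesis using bij_betw_inv_into[OF bij] by (simp add: mod_isos_def)
qed

text \<open>
  Any two copies of \<open>M\<close> in the universe are identified by an isomorphism compatible with the interior;
  \<open>B\<close> itself is such a copy.
\<close>

lemma interior_on_iso:
  fixes B :: "('r, 'u) module"
  assumes i: "relative_interior R i" and adm: "admissible_pair R C B"
    and \<phi>: "\<phi> \<in> mod_isos R B M"
  shows "interior_on R i M (\<phi> ` C) = \<phi> ` i B C"
proof -
  have B: "module R B" and Cs: "submodule C R B" using adm by (simp_all add: admissible_pair_def)
  interpret B: module R B by (rule B)
  have Cc: "C \<subseteq> carrier B" using B.submoduleE(1)[OF Cs] .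
  have iC: "i B C \<subseteq> C" using i[unfolded relative_interior_def, THEN conjunct1] adm by simp
  have inj: "inj_on \<phi> (carrier B)" and bij: "bij_betw \<phi> (carrier B) (carrier M)"
    using \<phi> by (auto simp: mod_isos_def bij_betw_def)
  have trans: "i U (\<psi> ` C) = \<psi> ` i B C" if "module R U" "\<psi> \<in> mod_isos R B U"
    for U :: "('r, 'u) module" and \<psi>
    using i[unfolded relative_interior_def, THEN conjunct2, THEN conjunct2, rule_format, OF adm that] .
  show ?thesis
  proof (intro equalityI subsetI)
    fix x assume "x \<in> interior_on R i M (\<phi> ` C)"
    then obtain U :: "('r, 'u) module" and \<psi> where x: "x \<in> carrier M" and U: "module R U"
      and \<psi>: "\<psi> \<in> mod_isos R M U" and xi: "\<psi> x \<in> i U (\<psi> ` \<phi> ` C)"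
      by (auto simp: interior_on_def)
    have "\<psi> x \<in> (\<psi> \<circ> \<phi>) ` i B C"
      using trans[OF U mod_isos_comp[OF \<phi> \<psi>]] xi by (simp add: image_comp)
    then obtain b where b: "b \<in> i B C" "\<psi> x = \<psi> (\<phi> b)" by auto
    have "\<phi> b \<in> carrier M" using b(1) iC Cc bij by (auto simp: bij_betw_def)
    then have "x = \<phi> b" using b(2) x \<psi> by (auto simp: mod_isos_def bij_betw_def dest: inj_onD)
    then show "x \<in> \<phi> ` i B C" using b(1) by simp
  next
    fix x assume "x \<in> \<phi> ` i B C"
    then obtain b where b: "b \<in> i B C" "x = \<phi> b" by auto
    let ?\<psi> = "inv_into (carrier B) \<phi>"
    have inv: "?\<psi> (\<phi> c) = c" if "c \<in> C" for c using that Cc inj by (auto simp: inv_into_f_f)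
    then have "?\<psi> ` \<phi> ` C = C" by (force simp: image_image)
    moreover have "?\<psi> x = b" using b iC inv by auto
    ultimately have "?\<psi> x \<in> i B (?\<psi> ` \<phi> ` C)" using b(1) by metis
    moreover have "x \<in> carrier M" using b iC Cc bij by (auto simp: bij_betw_def)
    ultimately show "x \<in> interior_on R i M (\<phi> ` C)"
      unfolding interior_on_def using B mod_isos_inv[OF B \<phi>] by blast
  qed
qed

lemma submodule_of_submodule:
  assumes "module R M" "submodule C R M" "submodule N R (M\<lparr>carrier := C\<rparr>)"
  shows "submodule N R M"
proof -
  interpret M: module R M by fact
  interpret C: module R "M\<lparr>carrier := C\<rparr>" using submodule.submodule_is_module[OF assms(2,1)] .
  show ?thesis using assms(2,3) unfolding M.submodule_iff C.submodule_iff by auto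
qed

lemma admissible_submodule:
  assumes adm: "admissible_pair R A B" and C: "submodule C R B"
  shows "admissible_pair R C B"
proof -
  have B: "module R B" using adm by (simp add: admissible_pair_def)
  note CM = submodule.submodule_is_module[OF C B]
  have "noetherian_module R B \<Longrightarrow> noetherian_module R (B\<lparr>carrier := C\<rparr>)"
    using CM submodule_of_submodule[OF B C] by (simp add: noetherian_module_def)
  moreover have "artinian_module R B \<Longrightarrow> artinian_module R (B\<lparr>carrier := C\<rparr>)"
    using CM submodule_of_submodule[OF B C] by (simp add: artinian_module_def)
  ultimately show ?thesis using adm C by (auto simp: admissible_pair_def)
qed

text \<open>
  Evaluation identifies \<open>B\<close> with its double dual and \<open>zeros L\<close> with the dual of the quotient by \<open>L\<close>, so the
  interior taken in the double dual is the image of the one taken in \<open>B\<close>. A functional \<open>f\<close> vanishes on this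
  image, under its own evaluation, exactly when it vanishes on the interior in \<open>B\<close>.
\<close>

lemma (in matlis_module) dual_closure_eq:
  assumes i: "relative_interior R i" and adm: "admissible_pair R A B"
    and L: "submodule L R (dual R E B)"
  shows "dual_closure R E i (dual R E B) L = perp (i B (zeros L))"
proof -
  let ?C = "zeros L"
  let ?D = "dual R E B"
  have C: "submodule ?C R B" by (rule zeros_submodule[OF D.submoduleE(1)[OF L]])
  have admC: "admissible_pair R ?C B" by (rule admissible_submodule[OF adm C])
  have I: "submodule (i B ?C) R B"
    using i[unfolded relative_interior_def, THEN conjunct1] admC by simp
  have hom: "eval_map R E B \<in> mod_homs R B (dual R E ?D)" by (rule eval_hom[OF B.module_axioms])
  have "interior_on R i (dual R E ?D) (dual_quot R E ?D L) = eval_map R E B ` i B ?C"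
    unfolding dual_quot_dual[OF L] by (rule interior_on_iso[OF i admC eval_iso])
  then have "dual_closure R E i ?D L =
      {f \<in> carrier ?D. eval_map R E ?D f \<in> dual_quot R E (dual R E ?D) (eval_map R E B ` i B ?C)}"
    by (simp add: dual_closure_def)
  also have "\<dots> = {f \<in> carrier ?D. \<forall>b\<in>i B ?C. f b = \<zero>\<^bsub>E\<^esub>}"
    unfolding dual_quot_eq[OF E.module_axioms DD.module_axioms
        hom_image_submodule[OF B.module_axioms DD.module_axioms hom I]]
    using mod_homs_closed[OF eval_hom[OF D.module_axioms]] mod_homs_closed[OF hom]
      B.submoduleE(1)[OF I]
    by (auto simp: eval_map_def subset_iff)
  finally show ?thesis by (simp add: perp_eq[OF I])
qed

theorem theorem6p2:
  fixes R :: "('r, 'x) ring_scheme"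
    and \<mm> :: "'r set"
    and E :: "('r, 'e) module"
    and i :: "('r, 'u) module \<Rightarrow> 'u set \<Rightarrow> 'u set"
    and A :: "'u set"
    and B :: "('r, 'u) module"
  assumes "local_cring R \<mm>"
    and "noetherian_ring R"
    and "adically_complete R \<mm>"
    and "large_universe R TYPE('u)"
    and "injective_hull R TYPE('u) (quot_module (ring_as_module R) \<mm>) E"
    and "relative_interior R i"
    and "admissible_pair R A B"
  shows "bij_betw (\<lambda>C. dual_quot R E B C)
           (expansions R i B A)
           (reductions R (dual_closure R E i) (dual R E B) (dual_quot R E B A)) \<and>
         (\<forall>C \<in> expansions R i B A. \<forall>D \<in> expansions R i B A.
            C \<subseteq> D \<longleftrightarrow> dual_quot R E B D \<subseteq> dual_quot R E B C)"
proof -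
  note i = assms(6) and adm = assms(7)
  obtain e0 where "complete_socle_module R \<mm> E e0"
    using injective_hull_socle[OF assms(1,2,3,5)] by auto
  moreover have "matlis_module_axioms R E B"
    using assms(5) adm
    by (auto simp: matlis_module_axioms_def injective_hull_def admissible_pair_def)
  ultimately interpret matlis_module R \<mm> E e0 B by (rule matlis_module.intro)
  have A: "submodule A R B" using adm by (simp add: admissible_pair_def)
  have I: "submodule (i B C) R B" if "submodule C R B" for C
    using i[unfolded relative_interior_def, THEN conjunct1] admissible_submodule[OF adm that] by simp
  have mono: "C \<subseteq> D \<longleftrightarrow> perp D \<subseteq> perp C" if "submodule C R B" "submodule D R B" for C D
  proof
    show "C \<subseteq> D \<Longrightarrow> perp D \<subseteq> perp C" using that by (auto simp: perp_eq)
    assume "perp D \<subseteq> perp C"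
    then have "zeros (perp C) \<subseteq> zeros (perp D)" by (auto simp: zeros_def)
    then show "C \<subseteq> D" by (simp add: zeros_perp that)
  qed
  have perp_eq_iff: "perp C = perp D \<longleftrightarrow> C = D" if "submodule C R B" "submodule D R B" for C D
    using zeros_perp that by metis
  have closure: "dual_closure R E i (dual R E B) (perp C) = perp (i B C)" if "submodule C R B" for C
    using dual_closure_eq[OF i adm perp_submodule[OF that]] zeros_perp[OF that] by simp
  have reductions_iff: "perp C \<in> reductions R (dual_closure R E i) (dual R E B) (perp A) \<longleftrightarrow>
      C \<in> expansions R i B A" if C: "submodule C R B" for C
    using C perp_submodule[OF C] mono[OF A C] perp_eq_iff[OF I[OF C] I[OF A]]
    by (auto simp: reductions_def expansions_def closure[OF C] closure[OF A])
  have sub: "submodule C R B" if "C \<in> expansions R i B A" for C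
    using that by (simp add: expansions_def)
  have "bij_betw perp (expansions R i B A)
    (reductions R (dual_closure R E i) (dual R E B) (perp A))"
  proof (rule bij_betwI[where g = zeros])
    show "perp \<in> expansions R i B A \<rightarrow> reductions R (dual_closure R E i) (dual R E B) (perp A)"
      using sub reductions_iff by auto
    show "zeros \<in> reductions R (dual_closure R E i) (dual R E B) (perp A) \<rightarrow> expansions R i B A"
    proof
      fix L assume L: "L \<in> reductions R (dual_closure R E i) (dual R E B) (perp A)"
      then have Ls: "submodule L R (dual R E B)" by (simp add: reductions_def)
      show "zeros L \<in> expansions R i B A"
        using reductions_iff[OF zeros_submodule[OF D.submoduleE(1)[OF Ls]]] perp_zeros[OF Ls] L by simp
    qed
    show "zeros (perp C) = C" if "C \<in> expansions R i B A" for C using zeros_perp[OF sub[OF that]] .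
    show "perp (zeros L) = L" if "L \<in> reductions R (dual_closure R E i) (dual R E B) (perp A)" for L
      using that by (intro perp_zeros) (simp add: reductions_def)
  qed
  then show ?thesis using mono sub by simp
qed

end
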